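(* Let $Q$ be a quiver. The categories $\mathrm{Rep}(Q,\mathbb{F}_1)$ (of $\mathbb{F}_1$-representations of $Q$) and $\mathcal{C}_Q$ (of windings over $Q$) are equivalent. This equivalence restricts to an equivalence between the full subcategory $\mathrm{Rep}(Q,\mathbb{F}_1)_{\mathrm{nil}}$ of nilpotent representations and the full subcategory of $\mathcal{C}_Q$ whose objects are the windings $F:S\to Q$ with $S$ acyclic.
   Context: A quiver $Q=(Q_0,Q_1,s,t)$ consists of a finite set $Q_0$ of vertices, a finite set $Q_1$ of arrows, and source and target maps $s,t:Q_1\to Q_0$ (loops and multiple arrows allowed). A quiver is acyclic if it contains no directed cycle. A quiver map is a pair of functions on vertices and arrows compatible with $s$ and $t$. A subquiver $S$ of $Q$ is full if every arrow of $Q$ with both endpoints in $S_0$ lies in $S_1$. An $\mathbb{F}_1$-vector space is a finite pointed set $(V,0_V)$; an $\mathbb{F}_1$-linear map $f:V\to W$ is a pointed function that is injective on $V\setminus f^{-1}(0_W)$. An $\mathbb{F}_1$-representation of $Q$ is a collection of $\mathbb{F}_1$-vector spaces $V_i$ ($i\in Q_0$) and $\mathbb{F}_1$-linear maps $f_\alpha:V_{s(\alpha)}\to V_{t(\alpha)}$ ($\alpha\in Q_1$). A morphism $(V_i,f_\alpha)\to(W_i,g_\alpha)$ is a collection of $\mathbb{F}_1$-linear maps $\phi_i:V_i\to W_i$ with $g_\alpha\phi_{s(\alpha)}=\phi_{t(\alpha)}f_\alpha$ for all $\alpha$. The representation is nilpotent if there is a positive integer $N$ such that for all $n\ge N$ the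 composition of the $f_\alpha$ along every directed path of length $n$ in $Q$ is the zero map. A winding is a quiver map $F:S\to Q$ such that whenever $\alpha\neq\beta$ in $S_1$ satisfy $s(\alpha)=s(\beta)$ or $t(\alpha)=t(\beta)$, then $F(\alpha)\neq F(\beta)$. For a full subquiver $T$ of $S$, $T_0$ is predecessor closed if for any directed path in $S$ from $v$ to $w$, $w\in T_0$ implies $v\in T_0$; it is successor closed if for any such path $v\in T_0$ implies $w\in T_0$. The category $\mathcal{C}_Q$ has as objects the windings $F:S\to Q$. A morphism $\phi:(S,F)\to(S',F')$ is a triple $(\mathcal{U}_\phi,\mathcal{D}_\phi,c_\phi)$ where $\mathcal{U}_\phi$ is a (possibly empty) full subquiver of $S$ with predecessor closed vertex set, $\mathcal{D}_\phi$ is a full subquiver of $S'$ with successor closed vertex set, and $c_\phi:\mathcal{U}_\phi\to\mathcal{D}_\phi$ is a quiver isomorphism with $F'|_{\mathcal{D}_\phi}\circ c_\phi=F|_{\mathcal{U}_\phi}$. The composition of $\phi:(S,F)\to(S',F')$ and $\psi:(S',F')\to(S'',F'')$ is $$\psi\circ\phi=\bigl(c_\phi^{-1}(\mathcal{U}_\psi\cap\mathcal{D}_\phi),\ c_\psi(\mathcal{U}_\psi\cap\mathcal{D}_\phi),\ c_\psi\circ c_\phi\bigr),$$ with $c_\psi\circ c_\phi$ restricted to $c_\phi^{-1}(\mathcal{U}_\psi\cap\mathcal{D}_\phi)$. The equivalence in question is the functor $\mathcal{C}_Q\to\mathrm{Rep}(Q,\mathbb{F}_1)$ sending a winding $F:S\to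 Q$ to the representation with $M_v=F^{-1}(v)\cup\{0\}$, in which $\alpha\in Q_1$ acts by $x\mapsto y$ if there is $\beta\in S_1$ with $s(\beta)=x$, $t(\beta)=y$, $F(\beta)=\alpha$, and $x\mapsto 0$ otherwise; a morphism $\phi$ is sent to the map with $x\mapsto c_\phi(x)$ if $x$ is a vertex of $\mathcal{U}_\phi$ and $x\mapsto 0$ otherwise. *)

theory Defs
  imports "HOL-Library.FuncSet"
begin

text \<open>
  All functions belonging to a mathematical object (source and target maps, quiver maps, linear
  maps, families indexed by vertices or arrows) are \<^emph>\<open>extensional\<close>, i.e. equal to
  \<^term>\<open>undefined\<close> outside their domain, so that HOL equality of objects and of morphisms is
  the mathematical equality.
\<close>

section \<open>Categories, functors and equivalences\<close>

text \<open>
  Hom-sets are indexed by pairs of objects and need not be disjoint; accordingly composition and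
  the action of a functor on morphisms receive the objects as arguments.
  \<open>Comp C X Y Z g f\<close> is the composite of \<open>f : X \<rightarrow> Y\<close> followed by
  \<open>g : Y \<rightarrow> Z\<close>.
\<close>

record ('o, 'm) cat =
  Ob :: "'o set"
  Hom :: "'o \<Rightarrow> 'o \<Rightarrow> 'm set"
  Comp :: "'o \<Rightarrow> 'o \<Rightarrow> 'o \<Rightarrow> 'm \<Rightarrow> 'm \<Rightarrow> 'm"
  Ident :: "'o \<Rightarrow> 'm"

definition category :: "('o, 'm) cat \<Rightarrow> bool" where
  "category C \<longleftrightarrow>
     (\<forall>X\<in>Ob C. Ident C X \<in> Hom C X X) \<and>
     (\<forall>X\<in>Ob C. \<forall>Y\<in>Ob C. \<forall>Z\<in>Ob C. \<forall>f\<in>Hom C X Y. \<forall>g\<in>Hom C Y Z.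
        Comp C X Y Z g f \<in> Hom C X Z) \<and>
     (\<forall>X\<in>Ob C. \<forall>Y\<in>Ob C. \<forall>f\<in>Hom C X Y.
        Comp C X X Y f (Ident C X) = f \<and> Comp C X Y Y (Ident C Y) f = f) \<and>
     (\<forall>W\<in>Ob C. \<forall>X\<in>Ob C. \<forall>Y\<in>Ob C. \<forall>Z\<in>Ob C.
        \<forall>f\<in>Hom C W X. \<forall>g\<in>Hom C X Y. \<forall>h\<in>Hom C Y Z.
          Comp C W Y Z h (Comp C W X Y g f) = Comp C W X Z (Comp C X Y Z h g) f)"

definition iso_in :: "('o, 'm) cat \<Rightarrow> 'o \<Rightarrow> 'o \<Rightarrow> 'm \<Rightarrow> bool" where
  "iso_in C X Y f \<longleftrightarrow> f \<in> Hom C X Y \<and>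
     (\<exists>g\<in>Hom C Y X. Comp C X Y X g f = Ident C X \<and> Comp C Y X Y f g = Ident C Y)"

definition full_subcategory :: "('o, 'm) cat \<Rightarrow> ('o \<Rightarrow> bool) \<Rightarrow> ('o, 'm) cat" where
  "full_subcategory C P = C\<lparr>Ob := {X \<in> Ob C. P X}\<rparr>"

record ('o, 'm, 'p, 'n) fctor =
  obj_map :: "'o \<Rightarrow> 'p"
  hom_map :: "'o \<Rightarrow> 'o \<Rightarrow> 'm \<Rightarrow> 'n"

definition is_functor ::
    "('o, 'm) cat \<Rightarrow> ('p, 'n) cat \<Rightarrow> ('o, 'm, 'p, 'n) fctor \<Rightarrow> bool" where
  "is_functor C D F \<longleftrightarrow> category C \<and> category D \<and>
     (\<forall>X\<in>Ob C. obj_map F X \<in> Ob D) \<and>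
     (\<forall>X\<in>Ob C. \<forall>Y\<in>Ob C. \<forall>f\<in>Hom C X Y. hom_map F X Y f \<in> Hom D (obj_map F X) (obj_map F Y)) \<and>
     (\<forall>X\<in>Ob C. hom_map F X X (Ident C X) = Ident D (obj_map F X)) \<and>
     (\<forall>X\<in>Ob C. \<forall>Y\<in>Ob C. \<forall>Z\<in>Ob C. \<forall>f\<in>Hom C X Y. \<forall>g\<in>Hom C Y Z.
        hom_map F X Z (Comp C X Y Z g f) =
          Comp D (obj_map F X) (obj_map F Y) (obj_map F Z) (hom_map F Y Z g) (hom_map F X Y f))"

definition id_functor :: "('o, 'm, 'o, 'm) fctor" where
  "id_functor = \<lparr>obj_map = (\<lambda>X. X), hom_map = (\<lambda>X Y f. f)\<rparr>"

definition comp_functor ::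
    "('p, 'n, 'q, 'k) fctor \<Rightarrow> ('o, 'm, 'p, 'n) fctor \<Rightarrow> ('o, 'm, 'q, 'k) fctor" where
  "comp_functor G F =
     \<lparr>obj_map = (\<lambda>X. obj_map G (obj_map F X)),
      hom_map = (\<lambda>X Y f. hom_map G (obj_map F X) (obj_map F Y) (hom_map F X Y f))\<rparr>"

definition natural_iso ::
    "('o, 'm) cat \<Rightarrow> ('p, 'n) cat \<Rightarrow> ('o, 'm, 'p, 'n) fctor \<Rightarrow> ('o, 'm, 'p, 'n) fctor
      \<Rightarrow> ('o \<Rightarrow> 'n) \<Rightarrow> bool" where
  "natural_iso C D F G \<tau> \<longleftrightarrow> is_functor C D F \<and> is_functor C D G \<and>
     (\<forall>X\<in>Ob C. iso_in D (obj_map F X) (obj_map G X) (\<tau> X)) \<and>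
     (\<forall>X\<in>Ob C. \<forall>Y\<in>Ob C. \<forall>f\<in>Hom C X Y.
        Comp D (obj_map F X) (obj_map F Y) (obj_map G Y) (\<tau> Y) (hom_map F X Y f) =
        Comp D (obj_map F X) (obj_map G X) (obj_map G Y) (hom_map G X Y f) (\<tau> X))"

definition cat_equivalence ::
    "('o, 'm) cat \<Rightarrow> ('p, 'n) cat \<Rightarrow> ('o, 'm, 'p, 'n) fctor \<Rightarrow> ('p, 'n, 'o, 'm) fctor
      \<Rightarrow> ('o \<Rightarrow> 'm) \<Rightarrow> ('p \<Rightarrow> 'n) \<Rightarrow> bool" where
  "cat_equivalence C D F G \<eta> \<epsilon> \<longleftrightarrow>
     is_functor C D F \<and> is_functor D C G \<and>
     natural_iso C C id_functor (comp_functor G F) \<eta> \<and>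
     natural_iso D D (comp_functor F G) id_functor \<epsilon>"

section \<open>Quivers\<close>

record ('v, 'e) quiver =
  verts :: "'v set"
  arrows :: "'e set"
  src :: "'e \<Rightarrow> 'v"
  tgt :: "'e \<Rightarrow> 'v"

definition is_quiver :: "('v, 'e) quiver \<Rightarrow> bool" where
  "is_quiver Q \<longleftrightarrow> finite (verts Q) \<and> finite (arrows Q) \<and>
     src Q \<in> arrows Q \<rightarrow>\<^sub>E verts Q \<and> tgt Q \<in> arrows Q \<rightarrow>\<^sub>E verts Q"

inductive dpath :: "('v, 'e) quiver \<Rightarrow> 'v \<Rightarrow> 'e list \<Rightarrow> 'v \<Rightarrow> bool" for Q where
  dpath_Nil: "v \<in> verts Q \<Longrightarrow> dpath Q v [] v"
| dpath_Cons: "a \<in> arrows Q \<Longrightarrow> dpath Q (tgt Q a) p w \<Longrightarrow> dpath Q (src Q a) (a # p) w"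

definition acyclic_quiver :: "('v, 'e) quiver \<Rightarrow> bool" where
  "acyclic_quiver Q \<longleftrightarrow> \<not> (\<exists>v p. p \<noteq> [] \<and> dpath Q v p v)"

definition is_subquiver :: "('v, 'e) quiver \<Rightarrow> ('v, 'e) quiver \<Rightarrow> bool" where
  "is_subquiver T S \<longleftrightarrow> is_quiver T \<and> verts T \<subseteq> verts S \<and> arrows T \<subseteq> arrows S \<and>
     (\<forall>a\<in>arrows T. src T a = src S a \<and> tgt T a = tgt S a)"

definition full_subquiver :: "('v, 'e) quiver \<Rightarrow> ('v, 'e) quiver \<Rightarrow> bool" where
  "full_subquiver T S \<longleftrightarrow> is_subquiver T S \<and>
     (\<forall>a\<in>arrows S. src S a \<in> verts T \<and> tgt S a \<in> verts T \<longrightarrow> a \<in> arrows T)"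

definition predecessor_closed :: "('v, 'e) quiver \<Rightarrow> 'v set \<Rightarrow> bool" where
  "predecessor_closed S A \<longleftrightarrow> (\<forall>v p w. dpath S v p w \<longrightarrow> w \<in> A \<longrightarrow> v \<in> A)"

definition successor_closed :: "('v, 'e) quiver \<Rightarrow> 'v set \<Rightarrow> bool" where
  "successor_closed S A \<longleftrightarrow> (\<forall>v p w. dpath S v p w \<longrightarrow> v \<in> A \<longrightarrow> w \<in> A)"

definition sub_quiver :: "('v, 'e) quiver \<Rightarrow> 'v set \<Rightarrow> 'e set \<Rightarrow> ('v, 'e) quiver" where
  "sub_quiver S A B =
     \<lparr>verts = A, arrows = B, src = restrict (src S) B, tgt = restrict (tgt S) B\<rparr>"

text \<open>Only used for two subquivers of a common quiver.\<close>

definition quiver_inter :: "('v, 'e) quiver \<Rightarrow> ('v, 'e) quiver \<Rightarrow> ('v, 'e) quiver" where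
  "quiver_inter T T' = sub_quiver T (verts T \<inter> verts T') (arrows T \<inter> arrows T')"

record ('v, 'e, 'w, 'f) qmap =
  vmap :: "'v \<Rightarrow> 'w"
  amap :: "'e \<Rightarrow> 'f"

definition quiver_map ::
    "('v, 'e) quiver \<Rightarrow> ('w, 'f) quiver \<Rightarrow> ('v, 'e, 'w, 'f) qmap \<Rightarrow> bool" where
  "quiver_map S Q F \<longleftrightarrow>
     vmap F \<in> verts S \<rightarrow>\<^sub>E verts Q \<and> amap F \<in> arrows S \<rightarrow>\<^sub>E arrows Q \<and>
     (\<forall>a\<in>arrows S. src Q (amap F a) = vmap F (src S a) \<and> tgt Q (amap F a) = vmap F (tgt S a))"

definition qmap_id :: "('v, 'e) quiver \<Rightarrow> ('v, 'e, 'v, 'e) qmap" where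
  "qmap_id S = \<lparr>vmap = (\<lambda>v\<in>verts S. v), amap = (\<lambda>a\<in>arrows S. a)\<rparr>"

definition qmap_restrict ::
    "('v, 'e, 'w, 'f) qmap \<Rightarrow> ('v, 'e) quiver \<Rightarrow> ('v, 'e, 'w, 'f) qmap" where
  "qmap_restrict F T = \<lparr>vmap = restrict (vmap F) (verts T), amap = restrict (amap F) (arrows T)\<rparr>"

text \<open>\<open>qmap_comp T G F\<close> is the composite of \<open>F\<close> followed by \<open>G\<close>,
  restricted to \<open>T\<close>.\<close>

definition qmap_comp ::
    "('v, 'e) quiver \<Rightarrow> ('w, 'f, 'x, 'g) qmap \<Rightarrow> ('v, 'e, 'w, 'f) qmap \<Rightarrow> ('v, 'e, 'x, 'g) qmap" where
  "qmap_comp T G F =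
     \<lparr>vmap = compose (verts T) (vmap G) (vmap F), amap = compose (arrows T) (amap G) (amap F)\<rparr>"

definition quiver_iso ::
    "('v, 'e) quiver \<Rightarrow> ('w, 'f) quiver \<Rightarrow> ('v, 'e, 'w, 'f) qmap \<Rightarrow> bool" where
  "quiver_iso S T c \<longleftrightarrow> quiver_map S T c \<and>
     (\<exists>d. quiver_map T S d \<and> qmap_comp S d c = qmap_id S \<and> qmap_comp T c d = qmap_id T)"

text \<open>Preimage and image of a subquiver \<open>T\<close> under \<open>c : U \<rightarrow> D\<close>.\<close>

definition quiver_preimage ::
    "('v, 'e) quiver \<Rightarrow> ('v, 'e, 'w, 'f) qmap \<Rightarrow> ('w, 'f) quiver \<Rightarrow> ('v, 'e) quiver" where
  "quiver_preimage U c T =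
     sub_quiver U {v \<in> verts U. vmap c v \<in> verts T} {a \<in> arrows U. amap c a \<in> arrows T}"

definition quiver_image ::
    "('w, 'f) quiver \<Rightarrow> ('v, 'e, 'w, 'f) qmap \<Rightarrow> ('v, 'e) quiver \<Rightarrow> ('w, 'f) quiver" where
  "quiver_image D c T = sub_quiver D (vmap c ` verts T) (amap c ` arrows T)"

section \<open>Representations over the field with one element\<close>

record 'a f1_space =
  elems :: "'a set"
  f1_zero :: "'a"

definition is_f1_space :: "'a f1_space \<Rightarrow> bool" where
  "is_f1_space V \<longleftrightarrow> finite (elems V) \<and> f1_zero V \<in> elems V"

definition f1_linear :: "'a f1_space \<Rightarrow> 'b f1_space \<Rightarrow> ('a \<Rightarrow> 'b) \<Rightarrow> bool" where
  "f1_linear V W f \<longleftrightarrow> f \<in> elems V \<rightarrow>\<^sub>E elems W \<and> f (f1_zero V) = f1_zero W \<and>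
     inj_on f {x \<in> elems V. f x \<noteq> f1_zero W}"

record ('q, 'r, 'a) f1_rep =
  rep_space :: "'q \<Rightarrow> 'a f1_space"
  rep_map :: "'r \<Rightarrow> 'a \<Rightarrow> 'a"

definition is_f1_rep :: "('q, 'r) quiver \<Rightarrow> ('q, 'r, 'a) f1_rep \<Rightarrow> bool" where
  "is_f1_rep Q M \<longleftrightarrow>
     rep_space M \<in> extensional (verts Q) \<and> (\<forall>i\<in>verts Q. is_f1_space (rep_space M i)) \<and>
     rep_map M \<in> extensional (arrows Q) \<and>
     (\<forall>\<alpha>\<in>arrows Q. f1_linear (rep_space M (src Q \<alpha>)) (rep_space M (tgt Q \<alpha>)) (rep_map M \<alpha>))"

definition is_f1_rep_hom ::
    "('q, 'r) quiver \<Rightarrow> ('q, 'r, 'a) f1_rep \<Rightarrow> ('q, 'r, 'a) f1_rep \<Rightarrow> ('q \<Rightarrow> 'a \<Rightarrow> 'a) \<Rightarrow> bool" where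
  "is_f1_rep_hom Q M N \<phi> \<longleftrightarrow> \<phi> \<in> extensional (verts Q) \<and>
     (\<forall>i\<in>verts Q. f1_linear (rep_space M i) (rep_space N i) (\<phi> i)) \<and>
     (\<forall>\<alpha>\<in>arrows Q. let V = elems (rep_space M (src Q \<alpha>)) in
        compose V (rep_map N \<alpha>) (\<phi> (src Q \<alpha>)) = compose V (\<phi> (tgt Q \<alpha>)) (rep_map M \<alpha>))"

text \<open>The composite of the \<open>f\<^sub>\<alpha>\<close> along a path \<open>p\<close> is
  \<^term>\<open>fold (rep_map M) p\<close>, as \<^const>\<open>fold\<close> applies the head of the list first.\<close>

definition nilpotent_rep :: "('q, 'r) quiver \<Rightarrow> ('q, 'r, 'a) f1_rep \<Rightarrow> bool" where
  "nilpotent_rep Q M \<longleftrightarrow> (\<exists>N>0. \<forall>n\<ge>N. \<forall>v p w. dpath Q v p w \<and> length p = n \<longrightarrow>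
     (\<forall>x\<in>elems (rep_space M v). fold (rep_map M) p x = f1_zero (rep_space M w)))"

definition rep_cat :: "('q, 'r) quiver \<Rightarrow> (('q, 'r, 'a) f1_rep, 'q \<Rightarrow> 'a \<Rightarrow> 'a) cat" where
  "rep_cat Q =
     \<lparr>Ob = {M. is_f1_rep Q M},
      Hom = (\<lambda>M N. {\<phi>. is_f1_rep_hom Q M N \<phi>}),
      Comp = (\<lambda>L M N \<psi> \<phi>. \<lambda>i\<in>verts Q. compose (elems (rep_space L i)) (\<psi> i) (\<phi> i)),
      Ident = (\<lambda>M. \<lambda>i\<in>verts Q. \<lambda>x\<in>elems (rep_space M i). x)\<rparr>"

section \<open>Windings\<close>

type_synonym ('v, 'e, 'q, 'r) winding = "('v, 'e) quiver \<times> ('v, 'e, 'q, 'r) qmap"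

definition is_winding :: "('q, 'r) quiver \<Rightarrow> ('v, 'e, 'q, 'r) winding \<Rightarrow> bool" where
  "is_winding Q = (\<lambda>(S, F). is_quiver S \<and> quiver_map S Q F \<and>
     (\<forall>a\<in>arrows S. \<forall>b\<in>arrows S. a \<noteq> b \<and> (src S a = src S b \<or> tgt S a = tgt S b) \<longrightarrow>
        amap F a \<noteq> amap F b))"

record ('v, 'e) winding_mor =
  upart :: "('v, 'e) quiver"
  dpart :: "('v, 'e) quiver"
  cmap :: "('v, 'e, 'v, 'e) qmap"

definition is_winding_mor ::
    "('v, 'e, 'q, 'r) winding \<Rightarrow> ('v, 'e, 'q, 'r) winding \<Rightarrow> ('v, 'e) winding_mor \<Rightarrow> bool" where
  "is_winding_mor = (\<lambda>(S, F) (S', F') \<phi>.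
     full_subquiver (upart \<phi>) S \<and> predecessor_closed S (verts (upart \<phi>)) \<and>
     full_subquiver (dpart \<phi>) S' \<and> successor_closed S' (verts (dpart \<phi>)) \<and>
     quiver_iso (upart \<phi>) (dpart \<phi>) (cmap \<phi>) \<and>
     qmap_comp (upart \<phi>) (qmap_restrict F' (dpart \<phi>)) (cmap \<phi>) = qmap_restrict F (upart \<phi>))"

definition winding_mor_comp ::
    "('v, 'e) winding_mor \<Rightarrow> ('v, 'e) winding_mor \<Rightarrow> ('v, 'e) winding_mor" where
  "winding_mor_comp \<psi> \<phi> =
     (let I = quiver_inter (upart \<psi>) (dpart \<phi>);
          P = quiver_preimage (upart \<phi>) (cmap \<phi>) I
      in \<lparr>upart = P, dpart = quiver_image (dpart \<psi>) (cmap \<psi>) I,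
          cmap = qmap_comp P (cmap \<psi>) (cmap \<phi>)\<rparr>)"

definition winding_cat ::
    "('q, 'r) quiver \<Rightarrow> (('v, 'e, 'q, 'r) winding, ('v, 'e) winding_mor) cat" where
  "winding_cat Q =
     \<lparr>Ob = {X. is_winding Q X},
      Hom = (\<lambda>X Y. {\<phi>. is_winding_mor X Y \<phi>}),
      Comp = (\<lambda>X Y Z \<psi> \<phi>. winding_mor_comp \<psi> \<phi>),
      Ident = (\<lambda>(S, F). \<lparr>upart = S, dpart = S, cmap = qmap_id S\<rparr>)\<rparr>"

section \<open>The functor from windings to representations\<close>

text \<open>The added base point of \<open>M\<^sub>v\<close> is \<^term>\<open>None\<close>, so representations
  have elements in \<^typ>\<open>'v option\<close>. The types \<open>'v\<close>, \<open>'e\<close> of vertices and arrows of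
  windings serve as universes; they must be infinite to contain all finite quivers up to
  isomorphism, which essential surjectivity needs.\<close>

definition winding_space :: "('v, 'e, 'q, 'r) winding \<Rightarrow> 'q \<Rightarrow> 'v option f1_space" where
  "winding_space = (\<lambda>(S, F) v.
     \<lparr>elems = insert None (Some ` {x \<in> verts S. vmap F x = v}), f1_zero = None\<rparr>)"

definition winding_action :: "('v, 'e, 'q, 'r) winding \<Rightarrow> 'r \<Rightarrow> 'v option \<Rightarrow> 'v option" where
  "winding_action = (\<lambda>(S, F) \<alpha> m. case m of None \<Rightarrow> None | Some x \<Rightarrow>
     (if \<exists>b\<in>arrows S. src S b = x \<and> amap F b = \<alpha>
      then Some (THE y. \<exists>b\<in>arrows S. src S b = x \<and> tgt S b = y \<and> amap F b = \<alpha>)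
      else None))"

definition winding_rep ::
    "('q, 'r) quiver \<Rightarrow> ('v, 'e, 'q, 'r) winding \<Rightarrow> ('q, 'r, 'v option) f1_rep" where
  "winding_rep Q X =
     \<lparr>rep_space = (\<lambda>v\<in>verts Q. winding_space X v),
      rep_map = (\<lambda>\<alpha>\<in>arrows Q. \<lambda>m\<in>elems (winding_space X (src Q \<alpha>)). winding_action X \<alpha> m)\<rparr>"

definition winding_rep_hom ::
    "('q, 'r) quiver \<Rightarrow> ('v, 'e, 'q, 'r) winding \<Rightarrow> ('v, 'e) winding_mor
      \<Rightarrow> 'q \<Rightarrow> 'v option \<Rightarrow> 'v option" where
  "winding_rep_hom Q X \<phi> = (\<lambda>v\<in>verts Q. \<lambda>m\<in>elems (winding_space X v).
     case m of None \<Rightarrow> None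
     | Some x \<Rightarrow> (if x \<in> verts (upart \<phi>) then Some (vmap (cmap \<phi>) x) else None))"

definition winding_functor ::
    "('q, 'r) quiver \<Rightarrow>
     (('v, 'e, 'q, 'r) winding, ('v, 'e) winding_mor,
      ('q, 'r, 'v option) f1_rep, 'q \<Rightarrow> 'v option \<Rightarrow> 'v option) fctor" where
  "winding_functor Q =
     \<lparr>obj_map = winding_rep Q, hom_map = (\<lambda>X Y \<phi>. winding_rep_hom Q X \<phi>)\<rparr>"

end

theory Submission
  imports Defs
begin

text \<open>
  A representation of \<open>Q\<close> over the field with one element is a family of finite sets of nonzero
  elements, one for each vertex of \<open>Q\<close>, together with a partial injection for each arrow. Drawing an
  arrow from \<open>m\<close> to its image under \<open>\<alpha>\<close> whenever that image is nonzero gives a quiver with a map to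
  \<open>Q\<close>, the coefficient quiver. That \<open>\<alpha>\<close> acts as a function means that arrows with equal label and
  source agree; that it is injective means that arrows with equal label and target agree. These two
  conditions define a winding, so every representation comes from a winding up to isomorphism
  (\<open>is_winding_coefficient\<close>, \<open>coefficient_quiver_iso\<close>).

  A morphism between the representations of two windings is a partial injection on vertices, defined
  on the set \<open>U\<close> of vertices with nonzero image. Commuting with the action of \<open>Q\<close> means that \<open>U\<close> is
  predecessor closed, that its image is successor closed, and that the arrows inside the two sets
  correspond. The correspondence of arrows is determined by that of vertices, since an arrow of a
  winding is known from its source and label. Hence the functor is bijective on morphisms
  (\<open>winding_rep_hom_in_Hom\<close>, \<open>winding_rep_hom_inj\<close>, \<open>winding_rep_hom_surj\<close>). Faithfulness also yields
  the category axioms for windings: once composites of morphisms are known to be morphisms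
  (\<open>winding_mor_comp_closed\<close>), the axioms are inherited from representations (\<open>is_functor_if_faithful\<close>).
  A fully faithful and essentially surjective functor is an equivalence.

  A composite of structure maps along a path of \<open>Q\<close> is nonzero exactly when the path lifts to the
  winding \<open>S\<close>, so nilpotency bounds the length of paths in the finite quiver \<open>S\<close>, that is, excludes
  cycles (\<open>nilpotent_winding_rep_iff\<close>). As nilpotency is invariant under isomorphism, the same
  quasi-inverse and the same natural isomorphisms serve for the full subcategories
  (\<open>cat_equivalence_full_subcategory\<close>).
\<close>

section \<open>Fully faithful and essentially surjective functors\<close>

lemma Ident_in_Hom: "category C \<Longrightarrow> X \<in> Ob C \<Longrightarrow> Ident C X \<in> Hom C X X"
  by (simp add: category_def)

lemma Comp_in_Hom:
  "category C \<Longrightarrow> f \<in> Hom C X Y \<Longrightarrow> g \<in> Hom C Y Z \<Longrightarrow> X \<in> Ob C \<Longrightarrow> Y \<in> Ob C \<Longrightarrow> Z \<in> Ob C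
    \<Longrightarrow> Comp C X Y Z g f \<in> Hom C X Z"
  by (simp add: category_def)

lemma Comp_Ident_right:
  "category C \<Longrightarrow> f \<in> Hom C X Y \<Longrightarrow> X \<in> Ob C \<Longrightarrow> Y \<in> Ob C \<Longrightarrow> Comp C X X Y f (Ident C X) = f"
  by (simp add: category_def)

lemma Comp_Ident_left:
  "category C \<Longrightarrow> f \<in> Hom C X Y \<Longrightarrow> X \<in> Ob C \<Longrightarrow> Y \<in> Ob C \<Longrightarrow> Comp C X Y Y (Ident C Y) f = f"
  by (simp add: category_def)

lemma Comp_assoc:
  "category C \<Longrightarrow> f \<in> Hom C W X \<Longrightarrow> g \<in> Hom C X Y \<Longrightarrow> h \<in> Hom C Y Z
    \<Longrightarrow> W \<in> Ob C \<Longrightarrow> X \<in> Ob C \<Longrightarrow> Y \<in> Ob C \<Longrightarrow> Z \<in> Ob C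
    \<Longrightarrow> Comp C W X Z (Comp C X Y Z h g) f = Comp C W Y Z h (Comp C W X Y g f)"
  by (simp add: category_def)

lemma category_full_subcategory: "category C \<Longrightarrow> category (full_subcategory C P)"
  by (simp add: category_def full_subcategory_def)

lemma is_functor_full_subcategory:
  assumes "is_functor C D F" "\<And>X. X \<in> Ob C \<Longrightarrow> P X \<Longrightarrow> R (obj_map F X)"
  shows "is_functor (full_subcategory C P) (full_subcategory D R) F"
  using assms by (simp add: is_functor_def category_full_subcategory) (simp add: full_subcategory_def)

lemma natural_iso_full_subcategory:
  assumes "natural_iso C D F G \<tau>"
    and "\<And>X. X \<in> Ob C \<Longrightarrow> P X \<Longrightarrow> R (obj_map F X)" "\<And>X. X \<in> Ob C \<Longrightarrow> P X \<Longrightarrow> R (obj_map G X)"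
  shows "natural_iso (full_subcategory C P) (full_subcategory D R) F G \<tau>"
  using assms unfolding natural_iso_def
  by (simp add: is_functor_full_subcategory) (simp add: full_subcategory_def iso_in_def)

text \<open>
  The same quasi-inverse serves: as \<open>F (G N)\<close> is isomorphic to \<open>N\<close>, invariance of \<open>R\<close>
  under isomorphism forces \<open>G\<close> to send objects satisfying \<open>R\<close> to objects satisfying \<open>P\<close>.
\<close>

lemma cat_equivalence_full_subcategory:
  assumes E: "cat_equivalence C D F G \<eta> \<epsilon>"
    and PR: "\<And>X. X \<in> Ob C \<Longrightarrow> P X \<longleftrightarrow> R (obj_map F X)"
    and iso: "\<And>M N f. M \<in> Ob D \<Longrightarrow> N \<in> Ob D \<Longrightarrow> iso_in D M N f \<Longrightarrow> R N \<Longrightarrow> R M"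
  shows "cat_equivalence (full_subcategory C P) (full_subcategory D R) F G \<eta> \<epsilon>"
proof -
  have F: "is_functor C D F" and G: "is_functor D C G"
    and \<eta>: "natural_iso C C id_functor (comp_functor G F) \<eta>"
    and \<epsilon>: "natural_iso D D (comp_functor F G) id_functor \<epsilon>"
    using E by (auto simp: cat_equivalence_def)
  have GP: "P (obj_map G N)" if N: "N \<in> Ob D" "R N" for N
  proof -
    have GN: "obj_map G N \<in> Ob C" using G N by (simp add: is_functor_def)
    have FGN: "obj_map F (obj_map G N) \<in> Ob D" using F GN by (simp add: is_functor_def)
    have "iso_in D (obj_map F (obj_map G N)) N (\<epsilon> N)"
      using \<epsilon> N by (simp add: natural_iso_def comp_functor_def id_functor_def)
    then have "R (obj_map F (obj_map G N))" using iso FGN N by blast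
    then show ?thesis using PR GN by blast
  qed
  show ?thesis
    unfolding cat_equivalence_def
  proof (intro conjI)
    show "is_functor (full_subcategory C P) (full_subcategory D R) F"
      by (rule is_functor_full_subcategory[OF F]) (simp add: PR)
    show "is_functor (full_subcategory D R) (full_subcategory C P) G"
      by (rule is_functor_full_subcategory[OF G]) (rule GP)
    have FOb: "\<And>X. X \<in> Ob C \<Longrightarrow> obj_map F X \<in> Ob D" using F by (simp add: is_functor_def)
    have GOb: "\<And>N. N \<in> Ob D \<Longrightarrow> obj_map G N \<in> Ob C" using G by (simp add: is_functor_def)
    show "natural_iso (full_subcategory C P) (full_subcategory C P) id_functor (comp_functor G F) \<eta>"
      by (rule natural_iso_full_subcategory[OF \<eta>])
        (auto simp: id_functor_def comp_functor_def PR FOb intro: GP)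
    show "natural_iso (full_subcategory D R) (full_subcategory D R) (comp_functor F G) id_functor \<epsilon>"
      by (rule natural_iso_full_subcategory[OF \<epsilon>])
        (auto simp: id_functor_def comp_functor_def GP GOb simp flip: PR)
  qed
qed

text \<open>
  Associativity and the unit laws are equations between morphisms, so a faithful and multiplicative
  assignment into a category pulls them back. This is how the axioms for \<^const>\<open>winding_cat\<close>, in
  particular associativity of \<^const>\<open>winding_mor_comp\<close>, are obtained.
\<close>

lemma is_functor_if_faithful:
  assumes D: "category D"
    and ob: "\<And>X. X \<in> Ob C \<Longrightarrow> obj_map F X \<in> Ob D"
    and hom: "\<And>X Y f. X \<in> Ob C \<Longrightarrow> Y \<in> Ob C \<Longrightarrow> f \<in> Hom C X Y
      \<Longrightarrow> hom_map F X Y f \<in> Hom D (obj_map F X) (obj_map F Y)"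
    and faithful: "\<And>X Y. X \<in> Ob C \<Longrightarrow> Y \<in> Ob C \<Longrightarrow> inj_on (hom_map F X Y) (Hom C X Y)"
    and idC: "\<And>X. X \<in> Ob C \<Longrightarrow> Ident C X \<in> Hom C X X"
    and compC: "\<And>X Y Z f g. X \<in> Ob C \<Longrightarrow> Y \<in> Ob C \<Longrightarrow> Z \<in> Ob C \<Longrightarrow> f \<in> Hom C X Y \<Longrightarrow> g \<in> Hom C Y Z
      \<Longrightarrow> Comp C X Y Z g f \<in> Hom C X Z"
    and Fid: "\<And>X. X \<in> Ob C \<Longrightarrow> hom_map F X X (Ident C X) = Ident D (obj_map F X)"
    and Fcomp: "\<And>X Y Z f g. X \<in> Ob C \<Longrightarrow> Y \<in> Ob C \<Longrightarrow> Z \<in> Ob C \<Longrightarrow> f \<in> Hom C X Y \<Longrightarrow> g \<in> Hom C Y Z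
      \<Longrightarrow> hom_map F X Z (Comp C X Y Z g f) =
          Comp D (obj_map F X) (obj_map F Y) (obj_map F Z) (hom_map F Y Z g) (hom_map F X Y f)"
  shows "is_functor C D F"
proof -
  note facts = D ob hom idC compC Fid Fcomp Comp_Ident_left Comp_Ident_right Comp_assoc
  have "category C"
    unfolding category_def
  proof (intro conjI ballI)
    fix X Y f assume XY: "X \<in> Ob C" "Y \<in> Ob C" "f \<in> Hom C X Y"
    show "Comp C X X Y f (Ident C X) = f" "Comp C X Y Y (Ident C Y) f = f"
      by (rule faithful[of X Y, THEN inj_onD]; simp add: XY facts)+
  next
    fix W X Y Z f g h
    assume "W \<in> Ob C" "X \<in> Ob C" "Y \<in> Ob C" "Z \<in> Ob C" "f \<in> Hom C W X" "g \<in> Hom C X Y" "h \<in> Hom C Y Z"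
    then show "Comp C W Y Z h (Comp C W X Y g f) = Comp C W X Z (Comp C X Y Z h g) f"
      by (intro faithful[of W Z, THEN inj_onD]; simp add: facts)
  qed (simp_all add: idC compC)
  then show ?thesis
    unfolding is_functor_def using assms by simp
qed

text \<open>
  The inverse is the preimage of the inverse; both composites are identities because their images are.
\<close>

lemma iso_in_reflected:
  assumes F: "is_functor C D F" and X: "X \<in> Ob C" and Y: "Y \<in> Ob C"
    and ff: "\<And>X Y. X \<in> Ob C \<Longrightarrow> Y \<in> Ob C \<Longrightarrow>
      bij_betw (hom_map F X Y) (Hom C X Y) (Hom D (obj_map F X) (obj_map F Y))"
    and f: "f \<in> Hom C X Y" and iso: "iso_in D (obj_map F X) (obj_map F Y) (hom_map F X Y f)"
  shows "iso_in C X Y f"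
proof -
  have C: "category C" using F by (simp add: is_functor_def)
  obtain g' where g': "g' \<in> Hom D (obj_map F Y) (obj_map F X)"
    and gf: "Comp D (obj_map F X) (obj_map F Y) (obj_map F X) g' (hom_map F X Y f) = Ident D (obj_map F X)"
    and fg: "Comp D (obj_map F Y) (obj_map F X) (obj_map F Y) (hom_map F X Y f) g' = Ident D (obj_map F Y)"
    using iso by (auto simp: iso_in_def)
  obtain g where g: "g \<in> Hom C Y X" "hom_map F Y X g = g'"
    using ff[OF Y X] g' unfolding bij_betw_def by force
  have "Comp C X Y X g f = Ident C X"
    by (rule ff[OF X X, THEN bij_betw_imp_inj_on, THEN inj_onD])
      (use F X Y f g gf in \<open>simp_all add: is_functor_def category_def\<close>)
  moreover have "Comp C Y X Y f g = Ident C Y"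
    by (rule ff[OF Y Y, THEN bij_betw_imp_inj_on, THEN inj_onD])
      (use F X Y f g fg in \<open>simp_all add: is_functor_def category_def\<close>)
  ultimately show ?thesis using f g by (auto simp: iso_in_def)
qed

text \<open>
  Choose an isomorphism \<open>e N : F (g N) \<rightarrow> N\<close> with inverse \<open>e' N\<close> for each \<open>N\<close>. On morphisms, \<open>G\<close> is
  conjugation by these isomorphisms followed by the inverse of the bijection on hom-sets. The counit
  is \<open>e\<close>, and the unit at \<open>X\<close> is the preimage of \<open>e' (F X)\<close>. Each required equation is
  checked after applying \<open>F\<close>, where \<open>e\<close> and \<open>e'\<close> cancel.
\<close>

theorem cat_equivalence_if_fully_faithful_ess_surj:
  assumes F: "is_functor C D F"
    and ff: "\<And>X Y. X \<in> Ob C \<Longrightarrow> Y \<in> Ob C \<Longrightarrow>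
      bij_betw (hom_map F X Y) (Hom C X Y) (Hom D (obj_map F X) (obj_map F Y))"
    and ess: "\<And>N. N \<in> Ob D \<Longrightarrow> \<exists>X\<in>Ob C. \<exists>f. iso_in D (obj_map F X) N f"
  shows "\<exists>G \<eta> \<epsilon>. cat_equivalence C D F G \<eta> \<epsilon>"
proof -
  let ?F = "obj_map F"
  have C: "category C" and D: "category D" using F by (auto simp: is_functor_def)
  have FOb: "?F X \<in> Ob D" if "X \<in> Ob C" for X using F that by (simp add: is_functor_def)
  have FHom: "hom_map F X Y f \<in> Hom D (?F X) (?F Y)"
    if "X \<in> Ob C" "Y \<in> Ob C" "f \<in> Hom C X Y" for X Y f using F that by (simp add: is_functor_def)
  have Fid: "hom_map F X X (Ident C X) = Ident D (?F X)" if "X \<in> Ob C" for X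
    using F that by (simp add: is_functor_def)
  have Fcomp: "hom_map F X Z (Comp C X Y Z g f) =
      Comp D (?F X) (?F Y) (?F Z) (hom_map F Y Z g) (hom_map F X Y f)"
    if "X \<in> Ob C" "Y \<in> Ob C" "Z \<in> Ob C" "f \<in> Hom C X Y" "g \<in> Hom C Y Z" for X Y Z f g
    using F that by (simp add: is_functor_def)
  define lift where "lift X Y = the_inv_into (Hom C X Y) (hom_map F X Y)" for X Y
  have lift: "lift X Y h \<in> Hom C X Y" "hom_map F X Y (lift X Y h) = h"
    if "X \<in> Ob C" "Y \<in> Ob C" "h \<in> Hom D (?F X) (?F Y)" for X Y h
    using ff[OF that(1,2)] that(3) unfolding lift_def bij_betw_def
    by (auto intro: the_inv_into_into f_the_inv_into_f)
  have faithful: "f = f'"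
    if "hom_map F X Y f = hom_map F X Y f'" "X \<in> Ob C" "Y \<in> Ob C" "f \<in> Hom C X Y" "f' \<in> Hom C X Y"
    for X Y f f'
    using ff[of X Y] that by (auto simp: bij_betw_def inj_on_def)
  have "\<forall>N. \<exists>X f f'. N \<in> Ob D \<longrightarrow> X \<in> Ob C \<and> f \<in> Hom D (?F X) N \<and> f' \<in> Hom D N (?F X) \<and>
      Comp D (?F X) N (?F X) f' f = Ident D (?F X) \<and> Comp D N (?F X) N f f' = Ident D N"
    using ess unfolding iso_in_def by blast
  then obtain g e e' where
    g: "\<And>N. N \<in> Ob D \<Longrightarrow> g N \<in> Ob C"
    and e: "\<And>N. N \<in> Ob D \<Longrightarrow> e N \<in> Hom D (?F (g N)) N"
    and e': "\<And>N. N \<in> Ob D \<Longrightarrow> e' N \<in> Hom D N (?F (g N))"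
    and e'e: "\<And>N. N \<in> Ob D \<Longrightarrow> Comp D (?F (g N)) N (?F (g N)) (e' N) (e N) = Ident D (?F (g N))"
    and ee': "\<And>N. N \<in> Ob D \<Longrightarrow> Comp D N (?F (g N)) N (e N) (e' N) = Ident D N"
    by metis
  have ee'_cancel: "Comp D K (?F (g N)) N (e N) (Comp D K N (?F (g N)) (e' N) h) = h"
    if "N \<in> Ob D" "K \<in> Ob D" "h \<in> Hom D K N" for N K h
    using that by (simp add: Comp_assoc[symmetric] Comp_Ident_left D FOb g e e' ee')
  define conj where "conj N N' f =
    Comp D (?F (g N)) N' (?F (g N')) (e' N') (Comp D (?F (g N)) N N' f (e N))" for N N' f
  have conj: "conj N N' f \<in> Hom D (?F (g N)) (?F (g N'))"
    if "N \<in> Ob D" "N' \<in> Ob D" "f \<in> Hom D N N'" for N N' f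
    unfolding conj_def using that by (simp add: D FOb g e e' Comp_in_Hom)
  define G where "G = \<lparr>obj_map = g, hom_map = (\<lambda>N N' f. lift (g N) (g N') (conj N N' f))\<rparr>"
  define \<eta> where "\<eta> X = lift X (g (?F X)) (e' (?F X))" for X
  note cat_facts = C D FOb FHom Fid Fcomp g e e' e'e ee' ee'_cancel conj lift
    Ident_in_Hom Comp_in_Hom Comp_Ident_left Comp_Ident_right Comp_assoc
  have G: "is_functor D C G"
    unfolding is_functor_def
  proof (intro conjI ballI)
    fix N assume N: "N \<in> Ob D"
    show "hom_map G N N (Ident D N) = Ident C (obj_map G N)"
      unfolding G_def fctor.simps
      by (rule faithful[of "g N" "g N"]) (use N in \<open>simp_all add: cat_facts\<close>, simp add: conj_def cat_facts)
  next
    fix K M N f h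
    assume "K \<in> Ob D" "M \<in> Ob D" "N \<in> Ob D" "f \<in> Hom D K M" "h \<in> Hom D M N"
    then show "hom_map G K N (Comp D K M N h f) =
        Comp C (obj_map G K) (obj_map G M) (obj_map G N) (hom_map G M N h) (hom_map G K M f)"
      unfolding G_def fctor.simps
      by (intro faithful[of "g K" "g N"]) (simp_all add: cat_facts, simp add: conj_def cat_facts)
  qed (simp_all add: G_def cat_facts)
  have GF: "is_functor C C (comp_functor G F)" and FG: "is_functor D D (comp_functor F G)"
    using F G by (simp_all add: is_functor_def comp_functor_def)
  have ids: "is_functor C C id_functor" "is_functor D D id_functor"
    using C D by (simp_all add: is_functor_def id_functor_def category_def)
  have "natural_iso C C id_functor (comp_functor G F) \<eta>"
    unfolding natural_iso_def
  proof (intro conjI ballI)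
    fix X assume X: "X \<in> Ob C"
    have "iso_in C X (g (?F X)) (\<eta> X)"
    proof (rule iso_in_reflected[OF F])
      show "iso_in D (?F X) (?F (g (?F X))) (hom_map F X (g (?F X)) (\<eta> X))"
        unfolding iso_in_def \<eta>_def using X by (auto simp: cat_facts intro!: bexI[of _ "e (?F X)"])
    qed (use X in \<open>simp_all add: cat_facts ff \<eta>_def\<close>)
    then show "iso_in C (obj_map id_functor X) (obj_map (comp_functor G F) X) (\<eta> X)"
      by (simp add: id_functor_def comp_functor_def G_def)
  next
    fix X Y f assume XY: "X \<in> Ob C" "Y \<in> Ob C" "f \<in> Hom C X Y"
    have "Comp C X Y (g (?F Y)) (\<eta> Y) f =
        Comp C X (g (?F X)) (g (?F Y)) (lift (g (?F X)) (g (?F Y)) (conj (?F X) (?F Y) (hom_map F X Y f))) (\<eta> X)"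
      unfolding \<eta>_def
      by (rule faithful[of X "g (?F Y)"]) (use XY in \<open>simp_all add: cat_facts\<close>, simp add: conj_def cat_facts)
    then show "Comp C (obj_map id_functor X) (obj_map id_functor Y) (obj_map (comp_functor G F) Y) (\<eta> Y)
          (hom_map id_functor X Y f) =
        Comp C (obj_map id_functor X) (obj_map (comp_functor G F) X) (obj_map (comp_functor G F) Y)
          (hom_map (comp_functor G F) X Y f) (\<eta> X)"
      by (simp add: id_functor_def comp_functor_def G_def)
  qed (fact ids GF)+
  moreover have "natural_iso D D (comp_functor F G) id_functor e"
    unfolding natural_iso_def
  proof (intro conjI ballI)
    fix N assume N: "N \<in> Ob D"
    then show "iso_in D (obj_map (comp_functor F G) N) (obj_map id_functor N) (e N)"
      by (auto simp: iso_in_def id_functor_def comp_functor_def G_def cat_facts intro!: bexI[of _ "e' N"])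
  next
    fix M N f assume "M \<in> Ob D" "N \<in> Ob D" "f \<in> Hom D M N"
    then show "Comp D (obj_map (comp_functor F G) M) (obj_map (comp_functor F G) N) (obj_map id_functor N) (e N)
          (hom_map (comp_functor F G) M N f) =
        Comp D (obj_map (comp_functor F G) M) (obj_map id_functor M) (obj_map id_functor N)
          (hom_map id_functor M N f) (e M)"
      by (simp add: id_functor_def comp_functor_def G_def cat_facts, simp add: conj_def cat_facts)
  qed (fact ids FG)+
  ultimately show ?thesis
    unfolding cat_equivalence_def using F G by blast
qed

section \<open>Representations over the field with one element\<close>

lemma src_in_verts: "is_quiver Q \<Longrightarrow> a \<in> arrows Q \<Longrightarrow> src Q a \<in> verts Q"
  and tgt_in_verts: "is_quiver Q \<Longrightarrow> a \<in> arrows Q \<Longrightarrow> tgt Q a \<in> verts Q"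
  by (auto simp: is_quiver_def)

lemma f1_linear_in: "f1_linear V W f \<Longrightarrow> x \<in> elems V \<Longrightarrow> f x \<in> elems W"
  by (auto simp: f1_linear_def)

lemma f1_linear_id: "is_f1_space V \<Longrightarrow> f1_linear V V (\<lambda>x\<in>elems V. x)"
  by (auto simp: f1_linear_def is_f1_space_def inj_on_def)

lemma f1_linear_compose:
  assumes f: "f1_linear U V f" and g: "f1_linear V W g" and U: "is_f1_space U"
  shows "f1_linear U W (compose (elems U) g f)"
proof -
  have f0: "f x \<noteq> f1_zero V" if "x \<in> elems U" "g (f x) \<noteq> f1_zero W" for x
    using g that by (auto simp: f1_linear_def)
  have "inj_on (compose (elems U) g f) {x \<in> elems U. compose (elems U) g f x \<noteq> f1_zero W}"
  proof (rule inj_onI)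
    fix x y
    assume "x \<in> {x \<in> elems U. compose (elems U) g f x \<noteq> f1_zero W}"
      and "y \<in> {x \<in> elems U. compose (elems U) g f x \<noteq> f1_zero W}"
      and eq: "compose (elems U) g f x = compose (elems U) g f y"
    then have xy: "x \<in> elems U" "y \<in> elems U" "g (f x) \<noteq> f1_zero W" "g (f y) \<noteq> f1_zero W" "g (f x) = g (f y)"
      by (auto simp: compose_def)
    then have "f x = f y"
      using g f1_linear_in[OF f] unfolding f1_linear_def inj_on_def by blast
    with xy f0 f show "x = y" unfolding f1_linear_def inj_on_def by blast
  qed
  then show ?thesis
    using f g U by (auto simp: f1_linear_def is_f1_space_def compose_def)
qed

lemma is_f1_rep_hom_iff:
  assumes "is_quiver Q" "is_f1_rep Q M"
  shows "is_f1_rep_hom Q M N \<phi> \<longleftrightarrow> \<phi> \<in> extensional (verts Q) \<and>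
     (\<forall>i\<in>verts Q. f1_linear (rep_space M i) (rep_space N i) (\<phi> i)) \<and>
     (\<forall>\<alpha>\<in>arrows Q. \<forall>x\<in>elems (rep_space M (src Q \<alpha>)).
        rep_map N \<alpha> (\<phi> (src Q \<alpha>) x) = \<phi> (tgt Q \<alpha>) (rep_map M \<alpha> x))"
proof -
  have *: "compose A f g = compose A h k \<longleftrightarrow> (\<forall>x\<in>A. f (g x) = h (k x))"
    for A :: "'x set" and f :: "'y \<Rightarrow> 'z" and g and h :: "'u \<Rightarrow> 'z" and k
    by (auto simp: compose_def restrict_def fun_eq_iff)
  show ?thesis by (simp add: is_f1_rep_hom_def Let_def *)
qed

lemma rep_map_in:
  "is_f1_rep Q M \<Longrightarrow> \<alpha> \<in> arrows Q \<Longrightarrow> x \<in> elems (rep_space M (src Q \<alpha>))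
    \<Longrightarrow> rep_map M \<alpha> x \<in> elems (rep_space M (tgt Q \<alpha>))"
  unfolding is_f1_rep_def by (blast intro: f1_linear_in)

lemma category_rep_cat:
  fixes Q :: "('q, 'r) quiver"
  assumes Q: "is_quiver Q"
  shows "category (rep_cat Q :: (('q, 'r, 'a) f1_rep, 'q \<Rightarrow> 'a \<Rightarrow> 'a) cat)"
proof -
  have in_elems: "\<phi> i x \<in> elems (rep_space N i)"
    if "is_f1_rep_hom Q M N \<phi>" "i \<in> verts Q" "x \<in> elems (rep_space M i)"
    for M N :: "('q, 'r, 'a) f1_rep" and \<phi> i x
    using that unfolding is_f1_rep_hom_def by (blast intro: f1_linear_in)
  have comp_eq: "(\<lambda>i\<in>verts Q. compose (elems (rep_space M i)) (\<chi> i) (\<xi> i)) = \<phi>"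
    if \<phi>: "is_f1_rep_hom Q M N \<phi>"
      and eq: "\<And>i x. i \<in> verts Q \<Longrightarrow> x \<in> elems (rep_space M i) \<Longrightarrow> \<chi> i (\<xi> i x) = \<phi> i x"
    for M N :: "('q, 'r, 'a) f1_rep" and \<phi> \<chi> \<xi>
  proof (rule extensionalityI[of _ "verts Q"])
    fix i assume i: "i \<in> verts Q"
    then have "\<phi> i \<in> extensional (elems (rep_space M i))"
      using \<phi> by (auto simp: is_f1_rep_hom_def f1_linear_def PiE_def)
    then have "compose (elems (rep_space M i)) (\<chi> i) (\<xi> i) = \<phi> i"
      using eq[OF i] by (intro extensionalityI[of _ "elems (rep_space M i)"]) (simp_all add: compose_eq)
    then show "(\<lambda>i\<in>verts Q. compose (elems (rep_space M i)) (\<chi> i) (\<xi> i)) i = \<phi> i" using i by simp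
  qed (use \<phi> in \<open>simp_all add: is_f1_rep_hom_def\<close>)
  show ?thesis
    unfolding category_def rep_cat_def cat.simps mem_Collect_eq
  proof (intro conjI ballI)
    fix M :: "('q, 'r, 'a) f1_rep" assume "M \<in> {M. is_f1_rep Q M}"
    then have M: "is_f1_rep Q M" by simp
    show "is_f1_rep_hom Q M M (\<lambda>i\<in>verts Q. \<lambda>x\<in>elems (rep_space M i). x)"
      using Q M unfolding is_f1_rep_hom_iff[OF Q M]
      by (auto simp: f1_linear_id is_f1_rep_def src_in_verts tgt_in_verts rep_map_in[OF M])
  next
    fix L M N :: "('q, 'r, 'a) f1_rep" and \<phi> \<psi>
    assume "L \<in> {M. is_f1_rep Q M}" "M \<in> {M. is_f1_rep Q M}"
      "\<phi> \<in> {\<phi>. is_f1_rep_hom Q L M \<phi>}" "\<psi> \<in> {\<phi>. is_f1_rep_hom Q M N \<phi>}"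
    then have L: "is_f1_rep Q L" and M: "is_f1_rep Q M"
      and \<phi>: "is_f1_rep_hom Q L M \<phi>" and \<psi>: "is_f1_rep_hom Q M N \<psi>" by auto
    show "is_f1_rep_hom Q L N (\<lambda>i\<in>verts Q. compose (elems (rep_space L i)) (\<psi> i) (\<phi> i))"
      unfolding is_f1_rep_hom_iff[OF Q L]
    proof (intro conjI ballI)
      fix i assume i: "i \<in> verts Q"
      have "f1_linear (rep_space L i) (rep_space N i) (compose (elems (rep_space L i)) (\<psi> i) (\<phi> i))"
        by (rule f1_linear_compose[where V = "rep_space M i"])
          (use \<phi> \<psi> L i in \<open>auto simp: is_f1_rep_hom_def is_f1_rep_def\<close>)
      then show "f1_linear (rep_space L i) (rep_space N i)
          ((\<lambda>i\<in>verts Q. compose (elems (rep_space L i)) (\<psi> i) (\<phi> i)) i)"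
        using i by simp
    next
      fix \<alpha> x assume \<alpha>: "\<alpha> \<in> arrows Q" and x: "x \<in> elems (rep_space L (src Q \<alpha>))"
      note st = src_in_verts[OF Q \<alpha>] tgt_in_verts[OF Q \<alpha>]
      have "rep_map N \<alpha> (\<psi> (src Q \<alpha>) (\<phi> (src Q \<alpha>) x)) = \<psi> (tgt Q \<alpha>) (rep_map M \<alpha> (\<phi> (src Q \<alpha>) x))"
        using \<psi> \<alpha> in_elems[OF \<phi> st(1) x] unfolding is_f1_rep_hom_iff[OF Q M] by blast
      also have "rep_map M \<alpha> (\<phi> (src Q \<alpha>) x) = \<phi> (tgt Q \<alpha>) (rep_map L \<alpha> x)"
        using \<phi> \<alpha> x unfolding is_f1_rep_hom_iff[OF Q L] by blast
      finally show "rep_map N \<alpha> ((\<lambda>i\<in>verts Q. compose (elems (rep_space L i)) (\<psi> i) (\<phi> i)) (src Q \<alpha>) x) =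
          (\<lambda>i\<in>verts Q. compose (elems (rep_space L i)) (\<psi> i) (\<phi> i)) (tgt Q \<alpha>) (rep_map L \<alpha> x)"
        using st x rep_map_in[OF L \<alpha> x] by (simp add: compose_eq)
    qed simp
  next
    fix M N :: "('q, 'r, 'a) f1_rep" and \<phi>
    assume "\<phi> \<in> {\<phi>. is_f1_rep_hom Q M N \<phi>}"
    then have \<phi>: "is_f1_rep_hom Q M N \<phi>" by simp
    show "(\<lambda>i\<in>verts Q. compose (elems (rep_space M i)) (\<phi> i)
        ((\<lambda>i\<in>verts Q. \<lambda>x\<in>elems (rep_space M i). x) i)) = \<phi>"
      by (rule comp_eq[OF \<phi>]) simp
    show "(\<lambda>i\<in>verts Q. compose (elems (rep_space M i))
        ((\<lambda>i\<in>verts Q. \<lambda>x\<in>elems (rep_space N i). x) i) (\<phi> i)) = \<phi>"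
      by (rule comp_eq[OF \<phi>]) (simp add: in_elems[OF \<phi>])
  next
    fix K L M N :: "('q, 'r, 'a) f1_rep" and \<phi> \<psi> \<chi>
    assume "\<phi> \<in> {\<phi>. is_f1_rep_hom Q K L \<phi>}"
    then have \<phi>: "is_f1_rep_hom Q K L \<phi>" by simp
    show "(\<lambda>i\<in>verts Q. compose (elems (rep_space K i)) (\<chi> i)
          ((\<lambda>i\<in>verts Q. compose (elems (rep_space K i)) (\<psi> i) (\<phi> i)) i)) =
        (\<lambda>i\<in>verts Q. compose (elems (rep_space K i))
          ((\<lambda>i\<in>verts Q. compose (elems (rep_space L i)) (\<chi> i) (\<psi> i)) i) (\<phi> i))"
      by (simp add: compose_def in_elems[OF \<phi>] cong: restrict_cong)
  qed
qed

text \<open>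
  A bijective pointed map is linear and so is its inverse; commuting with the structure maps passes
  to the inverse by cancelling \<open>\<phi>\<close> at the target.
\<close>

lemma iso_in_rep_cat_if_bij:
  assumes Q: "is_quiver Q" and M: "is_f1_rep Q M" and N: "is_f1_rep Q N"
    and \<phi>: "is_f1_rep_hom Q M N \<phi>"
    and bij: "\<And>i. i \<in> verts Q \<Longrightarrow> bij_betw (\<phi> i) (elems (rep_space M i)) (elems (rep_space N i))"
  shows "iso_in (rep_cat Q) M N \<phi>"
proof -
  define \<psi> where "\<psi> = (\<lambda>i\<in>verts Q. \<lambda>y\<in>elems (rep_space N i). inv_into (elems (rep_space M i)) (\<phi> i) y)"
  have \<phi>': "\<phi> \<in> extensional (verts Q)"
    "\<And>i. i \<in> verts Q \<Longrightarrow> f1_linear (rep_space M i) (rep_space N i) (\<phi> i)"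
    "\<And>\<alpha> x. \<alpha> \<in> arrows Q \<Longrightarrow> x \<in> elems (rep_space M (src Q \<alpha>))
      \<Longrightarrow> rep_map N \<alpha> (\<phi> (src Q \<alpha>) x) = \<phi> (tgt Q \<alpha>) (rep_map M \<alpha> x)"
    using \<phi> unfolding is_f1_rep_hom_iff[OF Q M] by auto
  have \<psi>_in: "\<psi> i y \<in> elems (rep_space M i)" and \<phi>\<psi>: "\<phi> i (\<psi> i y) = y"
    if "i \<in> verts Q" "y \<in> elems (rep_space N i)" for i y
    using bij[OF that(1)] that by (auto simp: \<psi>_def bij_betw_def intro: inv_into_into f_inv_into_f)
  have \<phi>_in: "\<phi> i x \<in> elems (rep_space N i)" and \<psi>\<phi>: "\<psi> i (\<phi> i x) = x"
    if "i \<in> verts Q" "x \<in> elems (rep_space M i)" for i x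
    using bij[OF that(1)] that by (auto simp: \<psi>_def bij_betw_def)
  have zero: "f1_zero (rep_space M i) \<in> elems (rep_space M i)" if "i \<in> verts Q" for i
    using M that by (simp add: is_f1_rep_def is_f1_space_def)
  have \<psi>0: "\<psi> i (f1_zero (rep_space N i)) = f1_zero (rep_space M i)" if "i \<in> verts Q" for i
    using \<psi>\<phi>[OF that zero[OF that]] \<phi>'(2)[OF that] by (simp add: f1_linear_def)
  have "is_f1_rep_hom Q N M \<psi>"
    unfolding is_f1_rep_hom_iff[OF Q N]
  proof (intro conjI ballI)
    show "\<psi> \<in> extensional (verts Q)" by (simp add: \<psi>_def)
    fix i assume i: "i \<in> verts Q"
    have "inj_on (\<psi> i) (elems (rep_space N i))"
      by (rule inj_on_inverseI[of _ "\<phi> i"]) (simp add: \<phi>\<psi> i)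
    then have "inj_on (\<psi> i) {y \<in> elems (rep_space N i). \<psi> i y \<noteq> f1_zero (rep_space M i)}"
      by (rule inj_on_subset) auto
    moreover have "\<psi> i \<in> elems (rep_space N i) \<rightarrow>\<^sub>E elems (rep_space M i)"
      using \<psi>_in i by (auto simp: \<psi>_def)
    ultimately show "f1_linear (rep_space N i) (rep_space M i) (\<psi> i)"
      using \<psi>0 i by (simp add: f1_linear_def)
  next
    fix \<alpha> y assume \<alpha>: "\<alpha> \<in> arrows Q" and y: "y \<in> elems (rep_space N (src Q \<alpha>))"
    note st = src_in_verts[OF Q \<alpha>] tgt_in_verts[OF Q \<alpha>]
    have "\<psi> (tgt Q \<alpha>) (rep_map N \<alpha> (\<phi> (src Q \<alpha>) (\<psi> (src Q \<alpha>) y))) = rep_map M \<alpha> (\<psi> (src Q \<alpha>) y)"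
      using \<phi>'(3)[OF \<alpha> \<psi>_in[OF st(1) y]] \<psi>\<phi>[OF st(2) rep_map_in[OF M \<alpha> \<psi>_in[OF st(1) y]]] by simp
    then show "rep_map M \<alpha> (\<psi> (src Q \<alpha>) y) = \<psi> (tgt Q \<alpha>) (rep_map N \<alpha> y)"
      by (simp add: \<phi>\<psi> st y)
  qed
  then show ?thesis
    unfolding iso_in_def
    using \<phi> by (intro conjI bexI[of _ \<psi>])
      (simp_all add: rep_cat_def compose_def \<psi>\<phi> \<phi>\<psi> cong: restrict_cong)
qed

lemma fold_rep_map_in:
  assumes "is_f1_rep Q M"
  shows "dpath Q v p w \<Longrightarrow> x \<in> elems (rep_space M v) \<Longrightarrow> fold (rep_map M) p x \<in> elems (rep_space M w)"
  by (induction arbitrary: x rule: dpath.induct) (simp_all add: rep_map_in[OF assms])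

lemma fold_rep_map_hom:
  assumes Q: "is_quiver Q" and M: "is_f1_rep Q M" and \<phi>: "is_f1_rep_hom Q M N \<phi>"
  shows "dpath Q v p w \<Longrightarrow> x \<in> elems (rep_space M v)
    \<Longrightarrow> fold (rep_map N) p (\<phi> v x) = \<phi> w (fold (rep_map M) p x)"
proof (induction arbitrary: x rule: dpath.induct)
  case (dpath_Cons a p w)
  have "rep_map N a (\<phi> (src Q a) x) = \<phi> (tgt Q a) (rep_map M a x)"
    using \<phi> dpath_Cons.hyps dpath_Cons.prems unfolding is_f1_rep_hom_iff[OF Q M] by blast
  then show ?case
    using dpath_Cons.IH[OF rep_map_in[OF M dpath_Cons.hyps(1) dpath_Cons.prems]] by simp
qed simp

lemma dpath_ends: "dpath Q v p w \<Longrightarrow> is_quiver Q \<Longrightarrow> v \<in> verts Q \<and> w \<in> verts Q"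
  by (induction rule: dpath.induct) (auto simp: src_in_verts)

text \<open>
  Composites along a path are conjugated by the isomorphism, so they vanish together.
\<close>

lemma nilpotent_rep_iso:
  assumes Q: "is_quiver Q" and M: "is_f1_rep Q M" and N: "is_f1_rep Q N"
    and iso: "iso_in (rep_cat Q) M N \<phi>" and nil: "nilpotent_rep Q N"
  shows "nilpotent_rep Q M"
proof -
  obtain \<psi> where \<phi>: "is_f1_rep_hom Q M N \<phi>" and \<psi>: "is_f1_rep_hom Q N M \<psi>"
    and eq: "(\<lambda>i\<in>verts Q. compose (elems (rep_space M i)) (\<psi> i) (\<phi> i)) =
      (\<lambda>i\<in>verts Q. \<lambda>x\<in>elems (rep_space M i). x)"
    using iso by (auto simp: iso_in_def rep_cat_def)
  have \<psi>\<phi>: "\<psi> i (\<phi> i x) = x" if "i \<in> verts Q" "x \<in> elems (rep_space M i)" for i x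
    using fun_cong[OF fun_cong[OF eq, of i], of x] that by (simp add: compose_eq)
  have \<phi>_in: "\<phi> i x \<in> elems (rep_space N i)" if "i \<in> verts Q" "x \<in> elems (rep_space M i)" for i x
    using \<phi> that unfolding is_f1_rep_hom_def by (blast intro: f1_linear_in)
  have "fold (rep_map M) p x = f1_zero (rep_space M w)"
    if p: "dpath Q v p w" and x: "x \<in> elems (rep_space M v)"
      and 0: "\<forall>y\<in>elems (rep_space N v). fold (rep_map N) p y = f1_zero (rep_space N w)" for v p w x
  proof -
    have vw: "v \<in> verts Q" "w \<in> verts Q" using dpath_ends[OF p Q] by auto
    have "fold (rep_map M) p x = \<psi> w (\<phi> w (fold (rep_map M) p x))"
      using \<psi>\<phi> vw fold_rep_map_in[OF M p x] by simp
    also have "\<dots> = \<psi> w (f1_zero (rep_space N w))"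
      using fold_rep_map_hom[OF Q M \<phi> p x] 0 \<phi>_in[OF vw(1) x] by simp
    also have "\<dots> = f1_zero (rep_space M w)"
      using \<psi> vw by (simp add: is_f1_rep_hom_def f1_linear_def)
    finally show ?thesis .
  qed
  with nil show ?thesis unfolding nilpotent_rep_def by meson
qed

section \<open>Full subquivers and morphisms of windings\<close>

text \<open>
  Closure under directed paths is closure under single arrows, by induction on the path.
\<close>

lemma predecessor_closed_iff:
  assumes "is_quiver S"
  shows "predecessor_closed S A \<longleftrightarrow> (\<forall>a\<in>arrows S. tgt S a \<in> A \<longrightarrow> src S a \<in> A)"
proof
  assume L: "predecessor_closed S A"
  show "\<forall>a\<in>arrows S. tgt S a \<in> A \<longrightarrow> src S a \<in> A"
  proof (intro ballI impI)
    fix a assume a: "a \<in> arrows S" "tgt S a \<in> A"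
    then have "dpath S (src S a) [a] (tgt S a)"
      by (intro dpath.intros tgt_in_verts assms)
    with L a show "src S a \<in> A" unfolding predecessor_closed_def by blast
  qed
next
  assume R: "\<forall>a\<in>arrows S. tgt S a \<in> A \<longrightarrow> src S a \<in> A"
  have "dpath S v p w \<Longrightarrow> w \<in> A \<Longrightarrow> v \<in> A" for v p w
    by (induction rule: dpath.induct) (use R in auto)
  then show "predecessor_closed S A" unfolding predecessor_closed_def by blast
qed

lemma successor_closed_iff:
  assumes "is_quiver S"
  shows "successor_closed S A \<longleftrightarrow> (\<forall>a\<in>arrows S. src S a \<in> A \<longrightarrow> tgt S a \<in> A)"
proof
  assume L: "successor_closed S A"
  show "\<forall>a\<in>arrows S. src S a \<in> A \<longrightarrow> tgt S a \<in> A"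
  proof (intro ballI impI)
    fix a assume a: "a \<in> arrows S" "src S a \<in> A"
    then have "dpath S (src S a) [a] (tgt S a)"
      by (intro dpath.intros tgt_in_verts assms)
    with L a show "tgt S a \<in> A" unfolding successor_closed_def by blast
  qed
next
  assume R: "\<forall>a\<in>arrows S. src S a \<in> A \<longrightarrow> tgt S a \<in> A"
  have "dpath S v p w \<Longrightarrow> v \<in> A \<Longrightarrow> w \<in> A" for v p w
    by (induction rule: dpath.induct) (use R in auto)
  then show "successor_closed S A" unfolding successor_closed_def by blast
qed

definition inner_arrows :: "('v, 'e) quiver \<Rightarrow> 'v set \<Rightarrow> 'e set" where
  "inner_arrows S A = {a \<in> arrows S. src S a \<in> A \<and> tgt S a \<in> A}"

definition induced_subquiver :: "('v, 'e) quiver \<Rightarrow> 'v set \<Rightarrow> ('v, 'e) quiver" where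
  "induced_subquiver S A = sub_quiver S A (inner_arrows S A)"

text \<open>
  A full subquiver is determined by its vertex set, its source and target maps being extensional.
  Hence morphisms of windings can be described by vertex sets.
\<close>

lemma full_subquiver_iff:
  assumes "is_quiver S"
  shows "full_subquiver T S \<longleftrightarrow> verts T \<subseteq> verts S \<and> T = induced_subquiver S (verts T)"
proof
  assume T: "full_subquiver T S"
  then have ar: "arrows T = inner_arrows S (verts T)"
    by (auto simp: full_subquiver_def is_subquiver_def inner_arrows_def dest: src_in_verts tgt_in_verts)
  have "src T = restrict (src S) (arrows T)" "tgt T = restrict (tgt S) (arrows T)"
    using T by (auto simp: full_subquiver_def is_subquiver_def is_quiver_def PiE_def
        intro!: extensionalityI[of _ "arrows T"])
  with T ar show "verts T \<subseteq> verts S \<and> T = induced_subquiver S (verts T)"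
    by (auto simp: induced_subquiver_def sub_quiver_def full_subquiver_def is_subquiver_def)
next
  assume T: "verts T \<subseteq> verts S \<and> T = induced_subquiver S (verts T)"
  have induced: "full_subquiver (induced_subquiver S A) S" if "A \<subseteq> verts S" for A
    using assms that
    by (auto simp: full_subquiver_def is_subquiver_def induced_subquiver_def sub_quiver_def
        inner_arrows_def is_quiver_def intro: finite_subset)
  show "full_subquiver T S"
    by (rule ssubst[where P = "\<lambda>X. full_subquiver X S", OF conjunct2[OF T]])
      (rule induced[OF conjunct1[OF T]])
qed

lemma is_quiver_induced: "is_quiver S \<Longrightarrow> A \<subseteq> verts S \<Longrightarrow> is_quiver (induced_subquiver S A)"
  by (auto simp: induced_subquiver_def sub_quiver_def inner_arrows_def is_quiver_def intro: finite_subset)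

lemma induced_simps [simp]:
  "verts (induced_subquiver S A) = A" "arrows (induced_subquiver S A) = inner_arrows S A"
  "a \<in> inner_arrows S A \<Longrightarrow> src (induced_subquiver S A) a = src S a"
  "a \<in> inner_arrows S A \<Longrightarrow> tgt (induced_subquiver S A) a = tgt S a"
  by (auto simp: induced_subquiver_def sub_quiver_def)

lemma quiver_iso_iff:
  assumes S: "is_quiver S"
  shows "quiver_iso S T c \<longleftrightarrow> quiver_map S T c \<and>
    bij_betw (vmap c) (verts S) (verts T) \<and> bij_betw (amap c) (arrows S) (arrows T)"
proof
  assume iso: "quiver_iso S T c"
  then obtain d where c: "quiver_map S T c" and d: "quiver_map T S d"
    and dc: "qmap_comp S d c = qmap_id S" and cd: "qmap_comp T c d = qmap_id T"
    unfolding quiver_iso_def by blast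
  have "vmap d (vmap c v) = v" if "v \<in> verts S" for v
    using fun_cong[OF arg_cong[OF dc, of vmap], of v] that by (simp add: qmap_comp_def qmap_id_def compose_def)
  moreover have "vmap c (vmap d v) = v" if "v \<in> verts T" for v
    using fun_cong[OF arg_cong[OF cd, of vmap], of v] that by (simp add: qmap_comp_def qmap_id_def compose_def)
  moreover have "amap d (amap c v) = v" if "v \<in> arrows S" for v
    using fun_cong[OF arg_cong[OF dc, of amap], of v] that by (simp add: qmap_comp_def qmap_id_def compose_def)
  moreover have "amap c (amap d v) = v" if "v \<in> arrows T" for v
    using fun_cong[OF arg_cong[OF cd, of amap], of v] that by (simp add: qmap_comp_def qmap_id_def compose_def)
  ultimately show "quiver_map S T c \<and>
    bij_betw (vmap c) (verts S) (verts T) \<and> bij_betw (amap c) (arrows S) (arrows T)"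
    using c d
    by (auto simp: quiver_map_def PiE_def intro!: bij_betw_byWitness[where f' = "vmap d"]
        bij_betw_byWitness[where f' = "amap d"])
next
  assume c: "quiver_map S T c \<and>
    bij_betw (vmap c) (verts S) (verts T) \<and> bij_betw (amap c) (arrows S) (arrows T)"
  define dv where "dv = restrict (inv_into (verts S) (vmap c)) (verts T)"
  define da where "da = restrict (inv_into (arrows S) (amap c)) (arrows T)"
  have v: "dv (vmap c x) = x" if "x \<in> verts S" for x
    using c that by (auto simp: dv_def bij_betw_def)
  have a: "da (amap c x) = x" if "x \<in> arrows S" for x
    using c that by (auto simp: da_def bij_betw_def)
  have vT: "\<exists>x\<in>verts S. y = vmap c x" if "y \<in> verts T" for y
    using c that by (auto simp: bij_betw_def)
  have aT: "\<exists>x\<in>arrows S. y = amap c x" if "y \<in> arrows T" for y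
    using c that by (auto simp: bij_betw_def)
  define d where "d = \<lparr>vmap = dv, amap = da\<rparr>"
  have "quiver_map T S d"
    unfolding quiver_map_def d_def qmap.simps
  proof (intro conjI ballI)
    show "dv \<in> verts T \<rightarrow>\<^sub>E verts S" "da \<in> arrows T \<rightarrow>\<^sub>E arrows S"
      using c by (auto simp: dv_def da_def bij_betw_def intro: inv_into_into)
    fix b assume "b \<in> arrows T"
    then obtain x where x: "x \<in> arrows S" "b = amap c x" using aT by blast
    have "src T b = vmap c (src S x)" "tgt T b = vmap c (tgt S x)"
      using c x by (auto simp: quiver_map_def)
    then show "src S (da b) = dv (src T b)" "tgt S (da b) = dv (tgt T b)"
      using x by (simp_all add: a v src_in_verts[OF S] tgt_in_verts[OF S])
  qed
  moreover have "qmap_comp S d c = qmap_id S"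
    using v a by (auto simp: qmap_comp_def qmap_id_def d_def compose_def cong: restrict_cong)
  moreover have "qmap_comp T c d = qmap_id T"
    using bij_betw_inv_into_right[of "vmap c" "verts S" "verts T"]
      bij_betw_inv_into_right[of "amap c" "arrows S" "arrows T"] c
    by (simp add: qmap_comp_def qmap_id_def d_def compose_def dv_def da_def cong: restrict_cong)
  ultimately show "quiver_iso S T c" using c unfolding quiver_iso_def by blast
qed

lemma compose_eq_restrict_iff: "compose A h k = restrict l A \<longleftrightarrow> (\<forall>x\<in>A. h (k x) = l x)"
  by (auto simp: compose_def restrict_def fun_eq_iff)

lemma bij_betw_extensional_iff:
  "f \<in> A \<rightarrow>\<^sub>E B \<and> bij_betw f A B \<longleftrightarrow> f \<in> extensional A \<and> bij_betw f A B"
  by (auto simp: PiE_def bij_betw_def)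

text \<open>
  Working form of a morphism: vertex sets \<open>U\<close> and \<open>D\<close>, closed under stepping back along an arrow and
  forward along an arrow respectively, and bijections \<open>f\<close> on vertices and \<open>g\<close> on the arrows between them.
\<close>

lemma is_winding_mor_iff:
  assumes S: "is_quiver S" and S': "is_quiver S'"
  shows "is_winding_mor (S, F) (S', F') \<lparr>upart = T, dpart = T', cmap = \<lparr>vmap = f, amap = g\<rparr>\<rparr> \<longleftrightarrow>
    (\<exists>U D. T = induced_subquiver S U \<and> T' = induced_subquiver S' D \<and> U \<subseteq> verts S \<and> D \<subseteq> verts S' \<and>
      (\<forall>a\<in>arrows S. tgt S a \<in> U \<longrightarrow> src S a \<in> U) \<and>
      (\<forall>a\<in>arrows S'. src S' a \<in> D \<longrightarrow> tgt S' a \<in> D) \<and>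
      f \<in> extensional U \<and> bij_betw f U D \<and>
      g \<in> extensional (inner_arrows S U) \<and> bij_betw g (inner_arrows S U) (inner_arrows S' D) \<and>
      (\<forall>v\<in>U. vmap F' (f v) = vmap F v) \<and>
      (\<forall>a\<in>inner_arrows S U. src S' (g a) = f (src S a) \<and> tgt S' (g a) = f (tgt S a) \<and>
        amap F' (g a) = amap F a))"
    (is "?L \<longleftrightarrow> (\<exists>U D. ?R U D)")
proof -
  have iff: "is_winding_mor (S, F) (S', F') \<lparr>upart = induced_subquiver S U, dpart = induced_subquiver S' D,
      cmap = \<lparr>vmap = f, amap = g\<rparr>\<rparr> \<longleftrightarrow>
      (\<forall>a\<in>arrows S. tgt S a \<in> U \<longrightarrow> src S a \<in> U) \<and>
      (\<forall>a\<in>arrows S'. src S' a \<in> D \<longrightarrow> tgt S' a \<in> D) \<and>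
      f \<in> extensional U \<and> bij_betw f U D \<and>
      g \<in> extensional (inner_arrows S U) \<and> bij_betw g (inner_arrows S U) (inner_arrows S' D) \<and>
      (\<forall>v\<in>U. vmap F' (f v) = vmap F v) \<and>
      (\<forall>a\<in>inner_arrows S U. src S' (g a) = f (src S a) \<and> tgt S' (g a) = f (tgt S a) \<and>
        amap F' (g a) = amap F a)" (is "_ \<longleftrightarrow> ?R'")
    if U: "U \<subseteq> verts S" and D: "D \<subseteq> verts S'" for U D
  proof -
    let ?U = "induced_subquiver S U" and ?D = "induced_subquiver S' D"
    let ?c = "\<lparr>vmap = f, amap = g\<rparr>"
    have map: "quiver_map ?U ?D ?c \<longleftrightarrow> f \<in> U \<rightarrow>\<^sub>E D \<and> g \<in> inner_arrows S U \<rightarrow>\<^sub>E inner_arrows S' D \<and>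
        (\<forall>a\<in>inner_arrows S U. src S' (g a) = f (src S a) \<and> tgt S' (g a) = f (tgt S a))"
    proof (cases "g \<in> inner_arrows S U \<rightarrow>\<^sub>E inner_arrows S' D")
      case True
      then have "\<And>a. a \<in> inner_arrows S U \<Longrightarrow> g a \<in> inner_arrows S' D" by (rule PiE_mem)
      then show ?thesis by (simp add: quiver_map_def)
    qed (simp add: quiver_map_def)
    have label: "qmap_comp ?U (qmap_restrict F' ?D) ?c = qmap_restrict F ?U \<longleftrightarrow>
        (\<forall>v\<in>U. vmap F' (f v) = vmap F v) \<and> (\<forall>a\<in>inner_arrows S U. amap F' (g a) = amap F a)"
      if f: "f \<in> U \<rightarrow>\<^sub>E D" and g: "g \<in> inner_arrows S U \<rightarrow>\<^sub>E inner_arrows S' D"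
    proof -
      show ?thesis
        using PiE_mem[OF f] PiE_mem[OF g]
        by (simp add: qmap_comp_def qmap_restrict_def compose_eq_restrict_iff)
    qed
    have "full_subquiver ?U S" "full_subquiver ?D S'"
      using U D by (auto simp: full_subquiver_iff S S')
    then have "is_winding_mor (S, F) (S', F') \<lparr>upart = ?U, dpart = ?D, cmap = ?c\<rparr> \<longleftrightarrow>
      (\<forall>a\<in>arrows S. tgt S a \<in> U \<longrightarrow> src S a \<in> U) \<and> (\<forall>a\<in>arrows S'. src S' a \<in> D \<longrightarrow> tgt S' a \<in> D) \<and>
      (quiver_map ?U ?D ?c \<and> bij_betw f U D \<and> bij_betw g (inner_arrows S U) (inner_arrows S' D)) \<and>
      qmap_comp ?U (qmap_restrict F' ?D) ?c = qmap_restrict F ?U"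
      by (simp add: is_winding_mor_def predecessor_closed_iff successor_closed_iff S S'
          quiver_iso_iff is_quiver_induced U)
    also have "\<dots> \<longleftrightarrow> ?R'"
      using label bij_betw_extensional_iff[of f U D]
        bij_betw_extensional_iff[of g "inner_arrows S U" "inner_arrows S' D"]
      unfolding map by blast
    finally show ?thesis .
  qed
  show ?thesis
  proof
    assume L: ?L
    then have "full_subquiver T S" "full_subquiver T' S'" by (simp_all add: is_winding_mor_def)
    then have TT': "verts T \<subseteq> verts S \<and> T = induced_subquiver S (verts T)"
      "verts T' \<subseteq> verts S' \<and> T' = induced_subquiver S' (verts T')"
      by (simp_all only: full_subquiver_iff[OF S] full_subquiver_iff[OF S'])
    obtain U D where UD: "T = induced_subquiver S U" "T' = induced_subquiver S' D"
      "U \<subseteq> verts S" "D \<subseteq> verts S'"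
      by (rule that[OF conjunct2[OF TT'(1)] conjunct2[OF TT'(2)] conjunct1[OF TT'(1)] conjunct1[OF TT'(2)]])
    have "?R U D" using L UD(3,4) unfolding UD(1,2) iff[OF UD(3,4)] by simp
    then show "\<exists>U D. ?R U D" by blast
  next
    assume "\<exists>U D. ?R U D"
    then obtain U D where R: "?R U D" by blast
    then have UD: "T = induced_subquiver S U" "T' = induced_subquiver S' D"
      "U \<subseteq> verts S" "D \<subseteq> verts S'" by simp_all
    show ?L using R unfolding UD(1,2) iff[OF UD(3,4)] by simp
  qed
qed

lemma is_windingD:
  assumes "is_winding Q (S, F)"
  shows "is_quiver S"
    and "v \<in> verts S \<Longrightarrow> vmap F v \<in> verts Q"
    and "a \<in> arrows S \<Longrightarrow> amap F a \<in> arrows Q"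
    and "a \<in> arrows S \<Longrightarrow> src Q (amap F a) = vmap F (src S a)"
    and "a \<in> arrows S \<Longrightarrow> tgt Q (amap F a) = vmap F (tgt S a)"
    and "a \<in> arrows S \<Longrightarrow> b \<in> arrows S \<Longrightarrow> amap F a = amap F b \<Longrightarrow> src S a = src S b \<Longrightarrow> a = b"
    and "a \<in> arrows S \<Longrightarrow> b \<in> arrows S \<Longrightarrow> amap F a = amap F b \<Longrightarrow> tgt S a = tgt S b \<Longrightarrow> a = b"
  using assms by (auto simp: is_winding_def quiver_map_def)

lemma winding_morE:
  assumes "is_winding_mor (S, F) (S', F') \<phi>" "is_quiver S" "is_quiver S'"
  obtains U D f g where
    "\<phi> = \<lparr>upart = induced_subquiver S U, dpart = induced_subquiver S' D, cmap = \<lparr>vmap = f, amap = g\<rparr>\<rparr>"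
    "U \<subseteq> verts S" "D \<subseteq> verts S'"
    "\<And>a. a \<in> arrows S \<Longrightarrow> tgt S a \<in> U \<Longrightarrow> src S a \<in> U"
    "\<And>a. a \<in> arrows S' \<Longrightarrow> src S' a \<in> D \<Longrightarrow> tgt S' a \<in> D"
    "f \<in> extensional U" "bij_betw f U D"
    "g \<in> extensional (inner_arrows S U)" "bij_betw g (inner_arrows S U) (inner_arrows S' D)"
    "\<And>v. v \<in> U \<Longrightarrow> vmap F' (f v) = vmap F v"
    "\<And>a. a \<in> inner_arrows S U \<Longrightarrow> src S' (g a) = f (src S a)"
    "\<And>a. a \<in> inner_arrows S U \<Longrightarrow> tgt S' (g a) = f (tgt S a)"
    "\<And>a. a \<in> inner_arrows S U \<Longrightarrow> amap F' (g a) = amap F a"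
proof -
  obtain T T' f g where \<phi>: "\<phi> = \<lparr>upart = T, dpart = T', cmap = \<lparr>vmap = f, amap = g\<rparr>\<rparr>"
    by (metis winding_mor.cases qmap.cases)
  from assms(1)[unfolded \<phi> is_winding_mor_iff[OF assms(2,3)]] show thesis
  proof (elim exE conjE)
    fix U D assume "T = induced_subquiver S U" "T' = induced_subquiver S' D"
    note eq = \<phi>[unfolded this]
    assume *: "U \<subseteq> verts S" "D \<subseteq> verts S'" "\<forall>a\<in>arrows S. tgt S a \<in> U \<longrightarrow> src S a \<in> U"
      "\<forall>a\<in>arrows S'. src S' a \<in> D \<longrightarrow> tgt S' a \<in> D"
      "f \<in> extensional U" "bij_betw f U D" "g \<in> extensional (inner_arrows S U)"
      "bij_betw g (inner_arrows S U) (inner_arrows S' D)"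
      "\<forall>v\<in>U. vmap F' (f v) = vmap F v"
      "\<forall>a\<in>inner_arrows S U. src S' (g a) = f (src S a) \<and> tgt S' (g a) = f (tgt S a) \<and>
        amap F' (g a) = amap F a"
    show thesis by (rule that[OF eq *(1,2) _ _ *(5-8)]) (simp_all add: *(3,4,9,10))
  qed
qed

lemma winding_mor_id:
  assumes "is_quiver S"
  shows "is_winding_mor (S, F) (S, F) \<lparr>upart = S, dpart = S, cmap = qmap_id S\<rparr>"
proof -
  have inner: "inner_arrows S (verts S) = arrows S"
    using src_in_verts[OF assms] tgt_in_verts[OF assms] by (auto simp: inner_arrows_def)
  have "full_subquiver S S" using assms by (simp add: full_subquiver_def is_subquiver_def)
  then have S: "S = induced_subquiver S (verts S)" by (simp only: full_subquiver_iff[OF assms])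
  show ?thesis
    unfolding qmap_id_def is_winding_mor_iff[OF assms assms]
    by (intro exI[of _ "verts S"] conjI S)
      (auto simp: inner src_in_verts[OF assms] tgt_in_verts[OF assms] bij_betw_def inj_on_def)
qed

text \<open>
  The composite is defined on \<open>P = {v \<in> U. f v \<in> U'}\<close>; since \<open>f\<close> maps \<open>U\<close> onto \<open>D\<close>, it sends \<open>P\<close> onto
  \<open>U' \<inter> D\<close>. The real content is that preimage and image of the intersection are again full
  (\<open>arrows_P\<close> and \<open>arrows_image\<close> in the proof), which follows from fullness of the four given
  subquivers and injectivity of the vertex maps.
\<close>

lemma winding_mor_comp_closed:
  assumes S: "is_quiver S" and S': "is_quiver S'" and S'': "is_quiver S''"
    and \<phi>: "is_winding_mor (S, F) (S', F') \<phi>" and \<psi>: "is_winding_mor (S', F') (S'', F'') \<psi>"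
  shows "is_winding_mor (S, F) (S'', F'') (winding_mor_comp \<psi> \<phi>)"
  using \<phi> S S'
proof (cases rule: winding_morE)
  case \<phi>: (1 U D f g)
  show ?thesis
    using \<psi> S' S''
  proof (cases rule: winding_morE)
    case \<psi>: (1 U' D' f' g')
    define P where "P = {v \<in> U. f v \<in> U'}"
    have fU: "f v \<in> D" if "v \<in> U" for v using \<phi>(7) that by (auto simp: bij_betw_def)
    have gU: "g a \<in> inner_arrows S' D" if "a \<in> inner_arrows S U" for a
      using \<phi>(9) that by (auto simp: bij_betw_def)
    have inner_inter: "inner_arrows S' U' \<inter> inner_arrows S' D = inner_arrows S' (U' \<inter> D)"
      by (auto simp: inner_arrows_def)
    have fP: "f ` P = U' \<inter> D" using \<phi>(7) by (auto simp: bij_betw_def P_def)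
    have arrows_P: "{a \<in> inner_arrows S U. g a \<in> inner_arrows S' (U' \<inter> D)} = inner_arrows S P"
    proof (intro set_eqI iffI)
      fix a assume "a \<in> {a \<in> inner_arrows S U. g a \<in> inner_arrows S' (U' \<inter> D)}"
      then have a: "a \<in> inner_arrows S U" "g a \<in> inner_arrows S' (U' \<inter> D)" by auto
      with \<phi>(11,12)[OF a(1)] show "a \<in> inner_arrows S P" by (auto simp: inner_arrows_def P_def)
    next
      fix a assume "a \<in> inner_arrows S P"
      then have a: "a \<in> inner_arrows S U" "f (src S a) \<in> U'" "f (tgt S a) \<in> U'"
        by (auto simp: inner_arrows_def P_def)
      with \<phi>(11,12)[OF a(1)] gU[OF a(1)]
      show "a \<in> {a \<in> inner_arrows S U. g a \<in> inner_arrows S' (U' \<inter> D)}" by (auto simp: inner_arrows_def)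
    qed
    have gP: "g ` inner_arrows S P = inner_arrows S' (U' \<inter> D)"
    proof -
      have "inner_arrows S' (U' \<inter> D) \<subseteq> g ` inner_arrows S U"
        using \<phi>(9) by (auto simp: bij_betw_def inner_arrows_def)
      then show ?thesis unfolding arrows_P[symmetric] by auto
    qed
    have arrows_image: "g' ` inner_arrows S' (U' \<inter> D) = inner_arrows S'' (f' ` (U' \<inter> D))"
    proof (intro set_eqI iffI)
      fix a'' assume "a'' \<in> g' ` inner_arrows S' (U' \<inter> D)"
      then obtain a where a: "a \<in> inner_arrows S' (U' \<inter> D)" "a'' = g' a" by blast
      then have a': "a \<in> inner_arrows S' U'" by (auto simp: inner_arrows_def)
      then have "g' a \<in> arrows S''" using \<psi>(9) by (auto simp: bij_betw_def inner_arrows_def)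
      with a \<psi>(11,12)[OF a'] show "a'' \<in> inner_arrows S'' (f' ` (U' \<inter> D))"
        by (auto simp: inner_arrows_def)
    next
      fix a'' assume a'': "a'' \<in> inner_arrows S'' (f' ` (U' \<inter> D))"
      have "f' ` (U' \<inter> D) \<subseteq> D'" using \<psi>(7) by (auto simp: bij_betw_def)
      with a'' have "a'' \<in> inner_arrows S'' D'" by (auto simp: inner_arrows_def)
      then obtain a where a: "a \<in> inner_arrows S' U'" "a'' = g' a" using \<psi>(9) by (auto simp: bij_betw_def)
      then have "f' (src S' a) \<in> f' ` (U' \<inter> D)" "f' (tgt S' a) \<in> f' ` (U' \<inter> D)"
        using a'' \<psi>(11,12)[OF a(1)] by (simp_all add: inner_arrows_def)
      moreover have "inj_on f' U'" "src S' a \<in> U'" "tgt S' a \<in> U'"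
        using \<psi>(7) a(1) by (auto simp: bij_betw_def inner_arrows_def)
      ultimately have "src S' a \<in> D" "tgt S' a \<in> D" by (auto simp: inj_on_def)
      with a show "a'' \<in> g' ` inner_arrows S' (U' \<inter> D)" by (auto simp: inner_arrows_def)
    qed
    have comp: "winding_mor_comp \<psi> \<phi> = \<lparr>upart = induced_subquiver S P,
        dpart = induced_subquiver S'' (f' ` (U' \<inter> D)),
        cmap = \<lparr>vmap = compose P f' f, amap = compose (inner_arrows S P) g' g\<rparr>\<rparr>"
    proof -
      have "{v \<in> U. f v \<in> U' \<inter> D} = P" using fU by (auto simp: P_def)
      then have "quiver_preimage (upart \<phi>) (cmap \<phi>) (quiver_inter (upart \<psi>) (dpart \<phi>)) = induced_subquiver S P"
        using arrows_P inner_inter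
        by (auto simp: quiver_preimage_def quiver_inter_def \<phi>(1) \<psi>(1) induced_subquiver_def sub_quiver_def
            inner_arrows_def P_def restrict_def)
      moreover have "quiver_image (dpart \<psi>) (cmap \<psi>) (quiver_inter (upart \<psi>) (dpart \<phi>)) =
          induced_subquiver S'' (f' ` (U' \<inter> D))"
      proof -
        have "inner_arrows S'' (f' ` (U' \<inter> D)) \<subseteq> inner_arrows S'' D'"
          using \<psi>(7) by (auto simp: bij_betw_def inner_arrows_def)
        then show ?thesis
          using arrows_image inner_inter
          by (auto simp: quiver_image_def quiver_inter_def \<phi>(1) \<psi>(1) induced_subquiver_def sub_quiver_def
              restrict_def fun_eq_iff)
      qed
      ultimately show ?thesis by (simp add: winding_mor_comp_def Let_def qmap_comp_def \<phi>(1) \<psi>(1))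
    qed
    show ?thesis
      unfolding comp is_winding_mor_iff[OF S S'']
    proof (rule exI[of _ P], rule exI[of _ "f' ` (U' \<inter> D)"], intro conjI ballI impI refl)
      show "P \<subseteq> verts S" "f' ` (U' \<inter> D) \<subseteq> verts S''"
        using \<phi>(2) \<psi>(3,7) by (auto simp: P_def bij_betw_def)
    next
      fix a assume a: "a \<in> arrows S" "tgt S a \<in> P"
      then have aU: "a \<in> inner_arrows S U" using \<phi>(4) by (auto simp: P_def inner_arrows_def)
      have "tgt S' (g a) \<in> U'" using a \<phi>(12)[OF aU] by (simp add: P_def)
      then have "src S' (g a) \<in> U'" using \<psi>(4) gU[OF aU] by (auto simp: inner_arrows_def)
      then show "src S a \<in> P" using \<phi>(11)[OF aU] aU by (simp add: P_def inner_arrows_def)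
    next
      fix a assume a: "a \<in> arrows S''" "src S'' a \<in> f' ` (U' \<inter> D)"
      then have "src S'' a \<in> D'" using \<psi>(7) by (auto simp: bij_betw_def)
      then have "a \<in> inner_arrows S'' D'" using \<psi>(5) a by (auto simp: inner_arrows_def)
      then obtain b where b: "b \<in> inner_arrows S' U'" "a = g' b" using \<psi>(9) by (auto simp: bij_betw_def)
      then have "f' (src S' b) \<in> f' ` (U' \<inter> D)" using a \<psi>(11) by simp
      then have "src S' b \<in> D" using \<psi>(7) b by (auto simp: bij_betw_def inj_on_def inner_arrows_def)
      then have "tgt S' b \<in> U' \<inter> D" using \<phi>(5) b by (auto simp: inner_arrows_def)
      then show "tgt S'' a \<in> f' ` (U' \<inter> D)" using b \<psi>(12) by simp
    next
      have "inj_on f P" "inj_on f' (U' \<inter> D)"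
        using \<phi>(7) \<psi>(7) by (auto simp: bij_betw_def P_def intro: inj_on_subset)
      then have "bij_betw (f' \<circ> f) P (f' ` (U' \<inter> D))"
        using bij_betw_trans[of f P "U' \<inter> D" f'] fP by (auto simp: bij_betw_def)
      then show "bij_betw (compose P f' f) P (f' ` (U' \<inter> D))"
        by (rule bij_betw_cong[THEN iffD1, rotated]) (simp add: compose_eq)
    next
      have "inj_on g (inner_arrows S P)" "inj_on g' (inner_arrows S' (U' \<inter> D))"
        using \<phi>(9) \<psi>(9) by (auto simp: bij_betw_def inner_arrows_def P_def intro: inj_on_subset)
      then have "bij_betw (g' \<circ> g) (inner_arrows S P) (inner_arrows S'' (f' ` (U' \<inter> D)))"
        using bij_betw_trans[of g "inner_arrows S P" "inner_arrows S' (U' \<inter> D)" g'] gP arrows_image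
        by (auto simp: bij_betw_def)
      then show "bij_betw (compose (inner_arrows S P) g' g) (inner_arrows S P)
          (inner_arrows S'' (f' ` (U' \<inter> D)))"
        by (rule bij_betw_cong[THEN iffD1, rotated]) (simp add: compose_eq)
    next
      fix v assume "v \<in> P"
      then show "vmap F'' (compose P f' f v) = vmap F v"
        using \<phi>(10) \<psi>(10) by (simp add: compose_eq P_def)
    next
      fix a assume a: "a \<in> inner_arrows S P"
      then have "a \<in> inner_arrows S U" "g a \<in> inner_arrows S' U'" "src S a \<in> P" "tgt S a \<in> P"
        using gP by (auto simp: inner_arrows_def P_def)
      then show "src S'' (compose (inner_arrows S P) g' g a) = compose P f' f (src S a)"
        "tgt S'' (compose (inner_arrows S P) g' g a) = compose P f' f (tgt S a)"
        "amap F'' (compose (inner_arrows S P) g' g a) = amap F a"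
        using a \<phi>(11-13) \<psi>(11-13) by (simp_all add: compose_eq)
    qed simp_all
  qed
qed

section \<open>The representation of a winding\<close>

text \<open>
  With \<^const>\<open>None\<close> as base point, a linear map is a partial injection between the sets of nonzero
  elements.
\<close>

lemma f1_linear_option_iff:
  "f1_linear \<lparr>elems = insert None (Some ` A), f1_zero = None\<rparr>
     \<lparr>elems = insert None (Some ` B), f1_zero = None\<rparr> f \<longleftrightarrow>
   f \<in> extensional (insert None (Some ` A)) \<and> f None = None \<and>
   (\<forall>x\<in>A. \<forall>y. f (Some x) = Some y \<longrightarrow> y \<in> B) \<and>
   (\<forall>x\<in>A. \<forall>x'\<in>A. \<forall>y. f (Some x) = Some y \<longrightarrow> f (Some x') = Some y \<longrightarrow> x = x')" (is "?L \<longleftrightarrow> ?R")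
proof
  assume L: ?L
  then have f: "f \<in> insert None (Some ` A) \<rightarrow>\<^sub>E insert None (Some ` B)" "f None = None"
    and inj: "inj_on f {m \<in> insert None (Some ` A). f m \<noteq> None}"
    by (auto simp: f1_linear_def)
  have "x = x'" if "x \<in> A" "x' \<in> A" "f (Some x) = Some y" "f (Some x') = Some y" for x x' y
    using inj_onD[OF inj, of "Some x" "Some x'"] that by simp
  moreover have "y \<in> B" if "x \<in> A" "f (Some x) = Some y" for x y
    using PiE_mem[OF f(1), of "Some x"] that by auto
  moreover have "f \<in> extensional (insert None (Some ` A))" using f(1) by (simp add: PiE_def)
  ultimately show ?R using f(2) by blast
next
  assume ?R
  then have ext: "f \<in> extensional (insert None (Some ` A))" and None: "f None = None"
    and into: "\<And>x y. x \<in> A \<Longrightarrow> f (Some x) = Some y \<Longrightarrow> y \<in> B"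
    and inj: "\<And>x x' y. x \<in> A \<Longrightarrow> x' \<in> A \<Longrightarrow> f (Some x) = Some y \<Longrightarrow> f (Some x') = Some y \<Longrightarrow> x = x'"
    by blast+
  have "f m \<in> insert None (Some ` B)" if "m \<in> insert None (Some ` A)" for m
    using that None into by (cases "f m") auto
  then have "f \<in> insert None (Some ` A) \<rightarrow>\<^sub>E insert None (Some ` B)"
    using ext by (simp add: PiE_iff)
  moreover have "inj_on f {m \<in> insert None (Some ` A). f m \<noteq> None}"
  proof (rule inj_onI)
    fix m m' assume "m \<in> {m \<in> insert None (Some ` A). f m \<noteq> None}"
      "m' \<in> {m \<in> insert None (Some ` A). f m \<noteq> None}" and eq: "f m = f m'"
    then obtain x x' y where "m = Some x" "m' = Some x'" "x \<in> A" "x' \<in> A" "f m = Some y"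
      using None by auto
    then show "m = m'" using inj[of x x' y] eq by simp
  qed
  ultimately show ?L using None by (simp add: f1_linear_def)
qed

lemma option_eqI: "(\<And>z. x = Some z \<longleftrightarrow> y = Some z) \<Longrightarrow> x = y"
  by (cases x; cases y) auto

lemma winding_action_None [simp]: "winding_action X \<alpha> None = None"
  by (simp add: winding_action_def split: prod.split)

text \<open>
  In a winding an arrow is determined by its source and its label, so the definite description in
  \<^const>\<open>winding_action\<close> denotes the target of that arrow.
\<close>

lemma winding_action_Some_iff:
  assumes "is_winding Q (S, F)"
  shows "winding_action (S, F) \<alpha> (Some x) = Some y \<longleftrightarrow>
    (\<exists>b\<in>arrows S. src S b = x \<and> tgt S b = y \<and> amap F b = \<alpha>)"
proof (cases "\<exists>b\<in>arrows S. src S b = x \<and> amap F b = \<alpha>")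
  case True
  then obtain b where b: "b \<in> arrows S" "src S b = x" "amap F b = \<alpha>" by blast
  have uniq: "c = b" if "c \<in> arrows S" "src S c = x" "amap F c = \<alpha>" for c
    using is_windingD(6)[OF assms that(1) b(1)] that b by simp
  have "(THE z. \<exists>c\<in>arrows S. src S c = x \<and> tgt S c = z \<and> amap F c = \<alpha>) = tgt S b"
    by (rule the_equality) (use b uniq in blast)+
  then have "winding_action (S, F) \<alpha> (Some x) = Some (tgt S b)"
    using True by (simp add: winding_action_def)
  then show ?thesis using b uniq by (metis option.inject)
next
  case False
  then show ?thesis by (auto simp: winding_action_def)
qed

lemma winding_space_eq:
  "winding_space (S, F) v = \<lparr>elems = insert None (Some ` {x \<in> verts S. vmap F x = v}), f1_zero = None\<rparr>"
  by (simp add: winding_space_def)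

lemma rep_space_winding_rep [simp]:
  "v \<in> verts Q \<Longrightarrow> rep_space (winding_rep Q X) v = winding_space X v"
  by (simp add: winding_rep_def)

lemma rep_map_winding_rep:
  "\<alpha> \<in> arrows Q \<Longrightarrow> m \<in> elems (winding_space X (src Q \<alpha>))
    \<Longrightarrow> rep_map (winding_rep Q X) \<alpha> m = winding_action X \<alpha> m"
  by (simp add: winding_rep_def)

text \<open>
  An arrow of a winding is also determined by its target and its label; this makes the action of
  \<open>\<alpha>\<close> injective away from the preimage of zero.
\<close>

lemma is_f1_rep_winding_rep:
  assumes Q: "is_quiver Q" and X: "is_winding Q (S, F)"
  shows "is_f1_rep Q (winding_rep Q (S, F))"
  unfolding is_f1_rep_def
proof (intro conjI ballI)
  show "rep_space (winding_rep Q (S, F)) \<in> extensional (verts Q)"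
    "rep_map (winding_rep Q (S, F)) \<in> extensional (arrows Q)"
    by (simp_all add: winding_rep_def)
  show "is_f1_space (rep_space (winding_rep Q (S, F)) v)" if "v \<in> verts Q" for v
    using is_windingD(1)[OF X] that by (simp add: is_f1_space_def is_quiver_def winding_space_eq)
  fix \<alpha> assume \<alpha>: "\<alpha> \<in> arrows Q"
  have "f1_linear (winding_space (S, F) (src Q \<alpha>)) (winding_space (S, F) (tgt Q \<alpha>))
      (\<lambda>m\<in>elems (winding_space (S, F) (src Q \<alpha>)). winding_action (S, F) \<alpha> m)"
    unfolding winding_space_eq f1_linear_option_iff f1_space.simps
  proof (intro conjI ballI allI impI)
    fix x y
    assume "x \<in> {x \<in> verts S. vmap F x = src Q \<alpha>}" and "(\<lambda>m\<in>insert None (Some ` {x \<in> verts S. vmap F x = src Q \<alpha>}).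
        winding_action (S, F) \<alpha> m) (Some x) = Some y"
    then have "winding_action (S, F) \<alpha> (Some x) = Some y" by simp
    then obtain b where b: "b \<in> arrows S" "src S b = x" "tgt S b = y" "amap F b = \<alpha>"
      unfolding winding_action_Some_iff[OF X] by blast
    then show "y \<in> {x \<in> verts S. vmap F x = tgt Q \<alpha>}"
      using is_windingD(5)[OF X, of b] tgt_in_verts[OF is_windingD(1)[OF X], of b] by simp
    fix x' assume "x' \<in> {x \<in> verts S. vmap F x = src Q \<alpha>}" and
      "(\<lambda>m\<in>insert None (Some ` {x \<in> verts S. vmap F x = src Q \<alpha>}).
        winding_action (S, F) \<alpha> m) (Some x') = Some y"
    then have "winding_action (S, F) \<alpha> (Some x') = Some y" by simp
    then obtain b' where "b' \<in> arrows S" "src S b' = x'" "tgt S b' = y" "amap F b' = \<alpha>"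
      unfolding winding_action_Some_iff[OF X] by blast
    then show "x = x'" using is_windingD(7)[OF X, of b b'] b by simp
  qed simp_all
  then show "f1_linear (rep_space (winding_rep Q (S, F)) (src Q \<alpha>)) (rep_space (winding_rep Q (S, F)) (tgt Q \<alpha>))
      (rep_map (winding_rep Q (S, F)) \<alpha>)"
    using \<alpha> src_in_verts[OF Q \<alpha>] tgt_in_verts[OF Q \<alpha>] by (simp add: winding_rep_def)
qed

text \<open>
  The components of \<open>h\<close> are glued to a single partial map on the vertices of \<open>S\<close>. It preserves labels,
  so injectivity of the components is injectivity of the glued map.
\<close>

lemma hom_winding_rep_iff:
  assumes Q: "is_quiver Q" and X: "is_winding Q (S, F)" and Y: "is_winding Q (S', F')"
  shows "is_f1_rep_hom Q (winding_rep Q (S, F)) (winding_rep Q (S', F')) h \<longleftrightarrow>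
    h \<in> extensional (verts Q) \<and>
    (\<forall>i\<in>verts Q. h i \<in> extensional (elems (winding_space (S, F) i)) \<and> h i None = None) \<and>
    (\<forall>x\<in>verts S. \<forall>y. h (vmap F x) (Some x) = Some y \<longrightarrow> y \<in> verts S' \<and> vmap F' y = vmap F x) \<and>
    (\<forall>x\<in>verts S. \<forall>x'\<in>verts S. \<forall>y. h (vmap F x) (Some x) = Some y \<longrightarrow>
      h (vmap F x') (Some x') = Some y \<longrightarrow> x = x') \<and>
    (\<forall>\<alpha>\<in>arrows Q. \<forall>x\<in>verts S. vmap F x = src Q \<alpha> \<longrightarrow>
      winding_action (S', F') \<alpha> (h (vmap F x) (Some x)) = h (tgt Q \<alpha>) (winding_action (S, F) \<alpha> (Some x)))"
    (is "_ \<longleftrightarrow> ?ext \<and> ?ptd \<and> ?into \<and> ?inj \<and> ?comm")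
proof -
  have FQ: "vmap F x \<in> verts Q" if "x \<in> verts S" for x using is_windingD(2)[OF X that] .
  have lin: "(\<forall>i\<in>verts Q. f1_linear (rep_space (winding_rep Q (S, F)) i) (rep_space (winding_rep Q (S', F')) i) (h i))
      \<longleftrightarrow> ?ptd \<and> ?into \<and> ?inj"
  proof -
    let ?V = "\<lambda>i. {x \<in> verts S. vmap F x = i}" and ?W = "\<lambda>i. {y \<in> verts S'. vmap F' y = i}"
    have "f1_linear (rep_space (winding_rep Q (S, F)) i) (rep_space (winding_rep Q (S', F')) i) (h i) \<longleftrightarrow>
        h i \<in> extensional (elems (winding_space (S, F) i)) \<and> h i None = None \<and>
        (\<forall>x\<in>?V i. \<forall>y. h i (Some x) = Some y \<longrightarrow> y \<in> ?W i) \<and>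
        (\<forall>x\<in>?V i. \<forall>x'\<in>?V i. \<forall>y. h i (Some x) = Some y \<longrightarrow> h i (Some x') = Some y \<longrightarrow> x = x')"
      if "i \<in> verts Q" for i
      unfolding rep_space_winding_rep[OF that] winding_space_eq f1_linear_option_iff by simp
    then have "(\<forall>i\<in>verts Q. f1_linear (rep_space (winding_rep Q (S, F)) i) (rep_space (winding_rep Q (S', F')) i) (h i))
      \<longleftrightarrow> ?ptd \<and> (\<forall>i\<in>verts Q. \<forall>x\<in>?V i. \<forall>y. h i (Some x) = Some y \<longrightarrow> y \<in> ?W i) \<and>
        (\<forall>i\<in>verts Q. \<forall>x\<in>?V i. \<forall>x'\<in>?V i. \<forall>y. h i (Some x) = Some y \<longrightarrow> h i (Some x') = Some y \<longrightarrow> x = x')"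
      by (simp only: ball_conj_distrib conj_assoc cong: ball_cong)
    also have "(\<forall>i\<in>verts Q. \<forall>x\<in>?V i. \<forall>y. h i (Some x) = Some y \<longrightarrow> y \<in> ?W i) \<longleftrightarrow> ?into"
      using FQ by blast
    also have "?ptd \<and> ?into \<and>
        (\<forall>i\<in>verts Q. \<forall>x\<in>?V i. \<forall>x'\<in>?V i. \<forall>y. h i (Some x) = Some y \<longrightarrow> h i (Some x') = Some y \<longrightarrow> x = x')
      \<longleftrightarrow> ?ptd \<and> ?into \<and> ?inj"
    proof (intro conj_cong refl iffI)
      assume into: ?into
        and inj: "\<forall>i\<in>verts Q. \<forall>x\<in>?V i. \<forall>x'\<in>?V i. \<forall>y. h i (Some x) = Some y \<longrightarrow> h i (Some x') = Some y \<longrightarrow> x = x'"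
      show ?inj
      proof (intro ballI allI impI)
        fix x x' y
        assume x: "x \<in> verts S" "x' \<in> verts S" "h (vmap F x) (Some x) = Some y" "h (vmap F x') (Some x') = Some y"
        have "vmap F' y = vmap F x" "vmap F' y = vmap F x'" using into x by blast+
        then have eq: "vmap F x' = vmap F x" by simp
        show "x = x'"
          by (rule inj[rule_format, OF FQ[OF x(1)], of x x' y]) (use x eq in simp_all)
      qed
    next
      assume inj: ?inj
      show "\<forall>i\<in>verts Q. \<forall>x\<in>?V i. \<forall>x'\<in>?V i. \<forall>y. h i (Some x) = Some y \<longrightarrow> h i (Some x') = Some y \<longrightarrow> x = x'"
      proof (intro ballI allI impI)
        fix i x x' y assume "x \<in> ?V i" "x' \<in> ?V i" "h i (Some x) = Some y" "h i (Some x') = Some y"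
        then show "x = x'" by (intro inj[rule_format, of x x' y]) simp_all
      qed
    qed
    finally show ?thesis .
  qed
  have comm: "(\<forall>\<alpha>\<in>arrows Q. \<forall>m\<in>elems (rep_space (winding_rep Q (S, F)) (src Q \<alpha>)).
      rep_map (winding_rep Q (S', F')) \<alpha> (h (src Q \<alpha>) m) = h (tgt Q \<alpha>) (rep_map (winding_rep Q (S, F)) \<alpha> m)) \<longleftrightarrow> ?comm"
    if ?ptd ?into
  proof (rule ball_cong[OF refl])
    fix \<alpha> assume \<alpha>: "\<alpha> \<in> arrows Q"
    note st = src_in_verts[OF Q \<alpha>] tgt_in_verts[OF Q \<alpha>]
    have "h (src Q \<alpha>) m \<in> elems (winding_space (S', F') (src Q \<alpha>))"
      if "m \<in> elems (winding_space (S, F) (src Q \<alpha>))" for m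
      using that \<open>?into\<close> \<open>?ptd\<close> st by (cases "h (src Q \<alpha>) m") (auto simp: winding_space_eq)
    then show "(\<forall>m\<in>elems (rep_space (winding_rep Q (S, F)) (src Q \<alpha>)).
        rep_map (winding_rep Q (S', F')) \<alpha> (h (src Q \<alpha>) m) = h (tgt Q \<alpha>) (rep_map (winding_rep Q (S, F)) \<alpha> m))
      \<longleftrightarrow> (\<forall>x\<in>verts S. vmap F x = src Q \<alpha> \<longrightarrow> winding_action (S', F') \<alpha> (h (vmap F x) (Some x)) =
        h (tgt Q \<alpha>) (winding_action (S, F) \<alpha> (Some x)))"
      using \<open>?ptd\<close> st \<alpha> by (simp add: rep_map_winding_rep) (auto simp: winding_space_eq)
  qed
  show ?thesis
    unfolding is_f1_rep_hom_iff[OF Q is_f1_rep_winding_rep[OF Q X]] lin conj_assoc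
    by (intro conj_cong refl) (rule comm)
qed

section \<open>The functor is fully faithful\<close>

lemma winding_rep_hom_Some:
  assumes "is_winding Q (S, F)" "x \<in> verts S"
  shows "winding_rep_hom Q (S, F) \<phi> (vmap F x) (Some x) =
    (if x \<in> verts (upart \<phi>) then Some (vmap (cmap \<phi>) x) else None)"
  using is_windingD(2)[OF assms] assms(2) by (simp add: winding_rep_hom_def winding_space_eq)

lemma winding_rep_hom_None:
  assumes "v \<in> verts Q"
  shows "winding_rep_hom Q (S, F) \<phi> v None = None"
  using assms by (simp add: winding_rep_hom_def winding_space_eq)

text \<open>
  Linearity is injectivity of \<open>f\<close>; the point is commutation with the action. If \<open>f x\<close> is the source
  of an arrow labelled \<open>\<alpha>\<close>, that arrow runs inside \<open>D\<close>, which is successor closed, and lifts through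
  \<open>g\<close> to an arrow at \<open>x\<close>. If the arrow labelled \<open>\<alpha>\<close> at \<open>x\<close> ends in \<open>U\<close>, it runs inside \<open>U\<close>, which
  is predecessor closed, and is carried over by \<open>g\<close>.
\<close>

lemma winding_rep_hom_in_Hom:
  assumes Q: "is_quiver Q" and X: "is_winding Q (S, F)" and Y: "is_winding Q (S', F')"
    and \<phi>: "is_winding_mor (S, F) (S', F') \<phi>"
  shows "is_f1_rep_hom Q (winding_rep Q (S, F)) (winding_rep Q (S', F')) (winding_rep_hom Q (S, F) \<phi>)"
proof -
  note S = is_windingD(1)[OF X] and S' = is_windingD(1)[OF Y]
  show ?thesis
    using \<phi> S S'
  proof (cases rule: winding_morE)
    case \<phi>: (1 U D f g)
    let ?h = "winding_rep_hom Q (S, F) \<phi>"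
    have h: "?h (vmap F x) (Some x) = (if x \<in> U then Some (f x) else None)" if "x \<in> verts S" for x
      using winding_rep_hom_Some[OF X that] \<phi>(1) by simp
    have fD: "f x \<in> D" if "x \<in> U" for x using \<phi>(7) that by (auto simp: bij_betw_def)
    show ?thesis
      unfolding hom_winding_rep_iff[OF Q X Y]
    proof (intro conjI ballI allI impI)
      show "?h \<in> extensional (verts Q)" by (simp add: winding_rep_hom_def)
      show "?h i \<in> extensional (elems (winding_space (S, F) i))" if "i \<in> verts Q" for i
        using that by (simp add: winding_rep_hom_def)
      show "?h i None = None" if "i \<in> verts Q" for i using winding_rep_hom_None[OF that] .
      show "y \<in> verts S'" "vmap F' y = vmap F x"
        if "x \<in> verts S" "?h (vmap F x) (Some x) = Some y" for x y
        using that \<phi>(3,10) fD by (auto simp: h split: if_splits)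
      show "x = x'" if "x \<in> verts S" "x' \<in> verts S" "?h (vmap F x) (Some x) = Some y"
        "?h (vmap F x') (Some x') = Some y" for x x' y
        using that \<phi>(7) by (auto simp: h bij_betw_def inj_on_def split: if_splits)
    next
      fix \<alpha> x assume \<alpha>: "\<alpha> \<in> arrows Q" and x: "x \<in> verts S" "vmap F x = src Q \<alpha>"
      have "winding_action (S', F') \<alpha> (?h (vmap F x) (Some x)) = Some z \<longleftrightarrow>
          ?h (tgt Q \<alpha>) (winding_action (S, F) \<alpha> (Some x)) = Some z" for z
      proof
        assume L: "winding_action (S', F') \<alpha> (?h (vmap F x) (Some x)) = Some z"
        then have xU: "x \<in> U" by (simp add: h[OF x(1)] split: if_splits)
        then obtain b' where b': "b' \<in> arrows S'" "src S' b' = f x" "tgt S' b' = z" "amap F' b' = \<alpha>"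
          using L by (auto simp: h[OF x(1)] winding_action_Some_iff[OF Y])
        then have "b' \<in> inner_arrows S' D" using \<phi>(5)[of b'] fD[OF xU] by (simp add: inner_arrows_def)
        then obtain b where b: "b \<in> inner_arrows S U" "b' = g b" using \<phi>(9) by (auto simp: bij_betw_def)
        then have bS: "b \<in> arrows S" "src S b \<in> U" "tgt S b \<in> U" by (auto simp: inner_arrows_def)
        have "f (src S b) = f x" using \<phi>(11)[OF b(1)] b b' by simp
        then have "src S b = x" using \<phi>(7) bS xU by (auto simp: bij_betw_def inj_on_def)
        moreover have \<alpha>b: "amap F b = \<alpha>" using \<phi>(13)[OF b(1)] b b' by simp
        ultimately have "winding_action (S, F) \<alpha> (Some x) = Some (tgt S b)"
          using bS by (auto simp: winding_action_Some_iff[OF X])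
        moreover have "f (tgt S b) = z" using \<phi>(12)[OF b(1)] b b' by simp
        moreover have "tgt Q \<alpha> = vmap F (tgt S b)" using is_windingD(5)[OF X bS(1)] \<alpha>b by simp
        ultimately show "?h (tgt Q \<alpha>) (winding_action (S, F) \<alpha> (Some x)) = Some z"
          using bS \<phi>(2) h[of "tgt S b"] by auto
      next
        assume R: "?h (tgt Q \<alpha>) (winding_action (S, F) \<alpha> (Some x)) = Some z"
        have "winding_action (S, F) \<alpha> (Some x) \<noteq> None"
        proof
          assume "winding_action (S, F) \<alpha> (Some x) = None"
          then show False using R winding_rep_hom_None[OF tgt_in_verts[OF Q \<alpha>], of S F \<phi>] by simp
        qed
        then obtain b where b: "b \<in> arrows S" "src S b = x" "amap F b = \<alpha>"
          and y: "winding_action (S, F) \<alpha> (Some x) = Some (tgt S b)"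
          by (auto simp: winding_action_Some_iff[OF X])
        have "tgt Q \<alpha> = vmap F (tgt S b)" using is_windingD(5)[OF X b(1)] b by simp
        then have "tgt S b \<in> U" "z = f (tgt S b)"
          using R y h[OF tgt_in_verts[OF S b(1)]] by (auto split: if_splits)
        moreover from this have "x \<in> U" using \<phi>(4) b by blast
        ultimately have inner: "b \<in> inner_arrows S U" using b by (simp add: inner_arrows_def)
        then have "g b \<in> arrows S'" using \<phi>(9) by (auto simp: bij_betw_def inner_arrows_def)
        then have "winding_action (S', F') \<alpha> (Some (f x)) = Some z"
          using \<phi>(11-13)[OF inner] b \<open>z = f (tgt S b)\<close> by (auto simp: winding_action_Some_iff[OF Y])
        then show "winding_action (S', F') \<alpha> (?h (vmap F x) (Some x)) = Some z"
          using \<open>x \<in> U\<close> by (simp add: h[OF x(1)])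
      qed
      then show "winding_action (S', F') \<alpha> (?h (vmap F x) (Some x)) =
          ?h (tgt Q \<alpha>) (winding_action (S, F) \<alpha> (Some x))"
        by (rule option_eqI)
    qed
  qed
qed

text \<open>
  The linear map remembers \<open>U\<close> (where it is nonzero) and \<open>f\<close>, hence also \<open>D = f ` U\<close>. The map on arrows
  is then forced, as the image of an arrow has prescribed source and label in a winding.
\<close>

lemma winding_rep_hom_inj:
  assumes X: "is_winding Q (S, F)" and Y: "is_winding Q (S', F')"
    and \<phi>: "is_winding_mor (S, F) (S', F') \<phi>" and \<psi>: "is_winding_mor (S, F) (S', F') \<psi>"
    and eq: "winding_rep_hom Q (S, F) \<phi> = winding_rep_hom Q (S, F) \<psi>"
  shows "\<phi> = \<psi>"
proof -
  note S = is_windingD(1)[OF X] and S' = is_windingD(1)[OF Y]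
  show ?thesis
    using \<phi> S S'
  proof (cases rule: winding_morE)
    case \<phi>: (1 U D f g)
    show ?thesis
      using \<psi> S S'
    proof (cases rule: winding_morE)
      case \<psi>: (1 U' D' f' g')
      have parts: "verts (upart \<phi>) = U" "vmap (cmap \<phi>) = f" "verts (upart \<psi>) = U'" "vmap (cmap \<psi>) = f'"
        by (simp_all add: \<phi>(1) \<psi>(1))
      have h: "(if x \<in> U then Some (f x) else None) = (if x \<in> U' then Some (f' x) else None)"
        if "x \<in> verts S" for x
        using winding_rep_hom_Some[OF X that, of \<phi>] winding_rep_hom_Some[OF X that, of \<psi>]
        unfolding eq parts by simp
      have U: "U = U'"
        using h \<phi>(2) \<psi>(2) by (metis option.distinct(1) subset_antisym subsetD subsetI)
      have "f x = f' x" if "x \<in> U" for x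
        using h[of x] \<phi>(2) that U by auto
      then have f: "f = f'" using \<phi>(6) \<psi>(6) U by (auto intro: extensionalityI)
      then have D: "D = D'" using \<phi>(7) \<psi>(7) U by (auto simp: bij_betw_def)
      have "g a = g' a" if a: "a \<in> inner_arrows S U" for a
      proof (rule is_windingD(6)[OF Y])
        show "g a \<in> arrows S'" "g' a \<in> arrows S'"
          using \<phi>(9) \<psi>(9) a U by (auto simp: bij_betw_def inner_arrows_def)
      qed (use \<phi>(11,13) \<psi>(11,13) a U f in simp_all)
      then have "g = g'" using \<phi>(8) \<psi>(8) U by (auto intro: extensionalityI)
      with U f D show ?thesis using \<phi>(1) \<psi>(1) by simp
    qed
  qed
qed

text \<open>
  Take for \<open>U\<close> the set of vertices not sent to zero. Commutation with the action shows that \<open>U\<close> is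
  predecessor closed (\<open>h x = 0\<close> implies \<open>h (\<alpha> x) = \<alpha> (h x) = 0\<close>) and that arrows inside \<open>U\<close> have
  counterparts between the images (\<open>lift\<close> in the proof). Conversely, if an arrow labelled \<open>\<alpha>\<close> leaves
  \<open>f x\<close>, then \<open>h (\<alpha> x) = \<alpha> (h x)\<close> is nonzero, so that arrow comes from one at \<open>x\<close> inside \<open>U\<close>
  (\<open>arrow_back\<close>); this gives both that the image is successor closed and that the map on arrows is
  onto.
\<close>

lemma winding_rep_hom_surj:
  assumes Q: "is_quiver Q" and X: "is_winding Q (S, F)" and Y: "is_winding Q (S', F')"
    and h: "is_f1_rep_hom Q (winding_rep Q (S, F)) (winding_rep Q (S', F')) h"
  shows "\<exists>\<phi>. is_winding_mor (S, F) (S', F') \<phi> \<and> winding_rep_hom Q (S, F) \<phi> = h"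
proof -
  note S = is_windingD(1)[OF X] and S' = is_windingD(1)[OF Y]
  have h_ext: "h \<in> extensional (verts Q)"
    and h_ptd: "\<And>i. i \<in> verts Q \<Longrightarrow> h i \<in> extensional (elems (winding_space (S, F) i)) \<and> h i None = None"
    and h_into: "\<And>x y. x \<in> verts S \<Longrightarrow> h (vmap F x) (Some x) = Some y \<Longrightarrow> y \<in> verts S' \<and> vmap F' y = vmap F x"
    and h_inj: "\<And>x x' y. x \<in> verts S \<Longrightarrow> x' \<in> verts S \<Longrightarrow> h (vmap F x) (Some x) = Some y \<Longrightarrow>
      h (vmap F x') (Some x') = Some y \<Longrightarrow> x = x'"
    and h_comm: "\<And>\<alpha> x. \<alpha> \<in> arrows Q \<Longrightarrow> x \<in> verts S \<Longrightarrow> vmap F x = src Q \<alpha> \<Longrightarrow>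
      winding_action (S', F') \<alpha> (h (vmap F x) (Some x)) = h (tgt Q \<alpha>) (winding_action (S, F) \<alpha> (Some x))"
    using h unfolding hom_winding_rep_iff[OF Q X Y] by blast+
  define U where "U = {x \<in> verts S. h (vmap F x) (Some x) \<noteq> None}"
  define f where "f = (\<lambda>x\<in>U. the (h (vmap F x) (Some x)))"
  have U: "x \<in> U \<longleftrightarrow> h (vmap F x) (Some x) = Some (f x)" if "x \<in> verts S" for x
    using that by (auto simp: U_def f_def)
  have US: "U \<subseteq> verts S" by (auto simp: U_def)
  have comm: "winding_action (S', F') (amap F a) (h (vmap F (src S a)) (Some (src S a))) =
      h (vmap F (tgt S a)) (Some (tgt S a))" if a: "a \<in> arrows S" for a
  proof -
    have "winding_action (S, F) (amap F a) (Some (src S a)) = Some (tgt S a)"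
      using a by (auto simp: winding_action_Some_iff[OF X])
    then show ?thesis
      using h_comm[OF is_windingD(3)[OF X a] src_in_verts[OF S a]] is_windingD(4,5)[OF X a] by simp
  qed
  have lift: "\<exists>a'\<in>arrows S'. src S' a' = f (src S a) \<and> tgt S' a' = f (tgt S a) \<and> amap F' a' = amap F a"
    if a: "a \<in> inner_arrows S U" for a
  proof -
    have aS: "a \<in> arrows S" "src S a \<in> U" "tgt S a \<in> U" using a by (auto simp: inner_arrows_def)
    have "winding_action (S', F') (amap F a) (Some (f (src S a))) = Some (f (tgt S a))"
      using comm[OF aS(1)] U[OF subsetD[OF US aS(2)]] U[OF subsetD[OF US aS(3)]] aS(2,3) by simp
    then show ?thesis unfolding winding_action_Some_iff[OF Y] by blast
  qed
  define g where "g = (\<lambda>a\<in>inner_arrows S U. SOME a'. a' \<in> arrows S' \<and> src S' a' = f (src S a) \<and>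
    tgt S' a' = f (tgt S a) \<and> amap F' a' = amap F a)"
  have g: "g a \<in> arrows S'" "src S' (g a) = f (src S a)" "tgt S' (g a) = f (tgt S a)" "amap F' (g a) = amap F a"
    if "a \<in> inner_arrows S U" for a
    using someI_ex[OF lift[OF that, unfolded Bex_def]] that by (simp_all add: g_def)
  have f_inj: "x = x'" if "x \<in> U" "x' \<in> U" "f x = f x'" for x x'
    using h_inj[of x x' "f x"] U US that by (metis subsetD)
  have f_into: "f x \<in> verts S' \<and> vmap F' (f x) = vmap F x" if "x \<in> U" for x
    using h_into[of x "f x"] U US that by blast
  have arrow_back: "\<exists>a\<in>inner_arrows S U. src S a = x \<and> amap F a = amap F' a' \<and> f (tgt S a) = tgt S' a'"
    if a': "a' \<in> arrows S'" "src S' a' = f x" and x: "x \<in> U" for a' x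
  proof -
    have xS: "x \<in> verts S" using x US by blast
    have \<alpha>: "amap F' a' \<in> arrows Q" "src Q (amap F' a') = vmap F x"
      using is_windingD(3,4)[OF Y a'(1)] a'(2) f_into[OF x] by simp_all
    have "winding_action (S', F') (amap F' a') (Some (f x)) = Some (tgt S' a')"
      using a' by (auto simp: winding_action_Some_iff[OF Y])
    then have *: "h (tgt Q (amap F' a')) (winding_action (S, F) (amap F' a') (Some x)) = Some (tgt S' a')"
      using h_comm[OF \<alpha>(1) xS \<alpha>(2)[symmetric]] U[OF xS] x by simp
    then have "winding_action (S, F) (amap F' a') (Some x) \<noteq> None"
      using h_ptd[OF tgt_in_verts[OF Q \<alpha>(1)]] by (metis option.distinct(1))
    then obtain a where a: "a \<in> arrows S" "src S a = x" "amap F a = amap F' a'"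
      and y: "winding_action (S, F) (amap F' a') (Some x) = Some (tgt S a)"
      by (auto simp: winding_action_Some_iff[OF X])
    have "h (vmap F (tgt S a)) (Some (tgt S a)) = Some (tgt S' a')"
      using * y is_windingD(5)[OF X a(1)] a(3) by simp
    then have "tgt S a \<in> U" "f (tgt S a) = tgt S' a'"
      using tgt_in_verts[OF S a(1)] U[of "tgt S a"] by (auto simp: U_def)
    then show ?thesis using a x by (auto simp: inner_arrows_def)
  qed
  define \<phi> where "\<phi> = \<lparr>upart = induced_subquiver S U, dpart = induced_subquiver S' (f ` U),
    cmap = \<lparr>vmap = f, amap = g\<rparr>\<rparr>"
  have \<phi>: "is_winding_mor (S, F) (S', F') \<phi>"
    unfolding \<phi>_def is_winding_mor_iff[OF S S']
  proof (rule exI[of _ U], rule exI[of _ "f ` U"], intro conjI ballI impI refl)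
    show "U \<subseteq> verts S" by (fact US)
    show "f ` U \<subseteq> verts S'" using f_into by blast
    show "src S a \<in> U" if "a \<in> arrows S" "tgt S a \<in> U" for a
      using comm[OF that(1)] that src_in_verts[OF S that(1)]
      by (cases "h (vmap F (src S a)) (Some (src S a))") (simp_all add: U_def)
    show "tgt S' a' \<in> f ` U" if a': "a' \<in> arrows S'" "src S' a' \<in> f ` U" for a'
    proof -
      obtain x where x: "x \<in> U" "src S' a' = f x" using a'(2) by blast
      obtain a where "tgt S a \<in> U" "f (tgt S a) = tgt S' a'"
        using arrow_back[OF a'(1) x(2,1)] by (auto simp: inner_arrows_def)
      then show ?thesis by (metis imageI)
    qed
    show "f \<in> extensional U" "g \<in> extensional (inner_arrows S U)" by (simp_all add: f_def g_def)
    show "bij_betw f U (f ` U)" using f_inj by (intro inj_on_imp_bij_betw inj_onI) blast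
    show "bij_betw g (inner_arrows S U) (inner_arrows S' (f ` U))"
      unfolding bij_betw_def
    proof
      show "inj_on g (inner_arrows S U)"
      proof (rule inj_onI)
        fix a b assume ab: "a \<in> inner_arrows S U" "b \<in> inner_arrows S U" "g a = g b"
        then have "f (src S a) = f (src S b)" "amap F a = amap F b"
          using g(2,4)[OF ab(1)] g(2,4)[OF ab(2)] by simp_all
        moreover have "a \<in> arrows S" "b \<in> arrows S" "src S a \<in> U" "src S b \<in> U"
          using ab by (auto simp: inner_arrows_def)
        ultimately show "a = b" using f_inj is_windingD(6)[OF X] by blast
      qed
      show "g ` inner_arrows S U = inner_arrows S' (f ` U)"
      proof (intro set_eqI iffI)
        fix a' assume "a' \<in> g ` inner_arrows S U"
        then show "a' \<in> inner_arrows S' (f ` U)" using g by (auto simp: inner_arrows_def)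
      next
        fix a' assume "a' \<in> inner_arrows S' (f ` U)"
        then obtain x where a': "a' \<in> arrows S'" and x: "x \<in> U" "src S' a' = f x"
          by (auto simp: inner_arrows_def)
        obtain a where a: "a \<in> inner_arrows S U" "src S a = x" "amap F a = amap F' a'"
          using arrow_back[OF a' x(2,1)] by blast
        have "a' = g a"
          by (rule is_windingD(6)[OF Y a' g(1)[OF a(1)]]) (use a x g[OF a(1)] in simp_all)
        then show "a' \<in> g ` inner_arrows S U" using a by blast
      qed
    qed
  qed (use g f_into in simp_all)
  have "winding_rep_hom Q (S, F) \<phi> = h"
  proof (rule extensionalityI[of _ "verts Q"])
    fix v assume v: "v \<in> verts Q"
    show "winding_rep_hom Q (S, F) \<phi> v = h v"
    proof (rule extensionalityI[of _ "elems (winding_space (S, F) v)"])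
      fix m assume m: "m \<in> elems (winding_space (S, F) v)"
      show "winding_rep_hom Q (S, F) \<phi> v m = h v m"
      proof (cases m)
        case None
        then show ?thesis using h_ptd[OF v] winding_rep_hom_None[OF v] by simp
      next
        case (Some x)
        then have x: "x \<in> verts S" "vmap F x = v" using m by (auto simp: winding_space_eq)
        then show ?thesis
          using winding_rep_hom_Some[OF X x(1), of \<phi>] U[OF x(1)] Some
          by (auto simp: \<phi>_def U_def split: if_splits)
      qed
    qed (use h_ptd v in \<open>simp_all add: winding_rep_hom_def\<close>)
  qed (simp_all add: h_ext winding_rep_hom_def)
  with \<phi> show ?thesis by blast
qed

lemma winding_rep_hom_id:
  "winding_rep_hom Q (S, F) \<lparr>upart = S, dpart = S, cmap = qmap_id S\<rparr> =
    (\<lambda>i\<in>verts Q. \<lambda>x\<in>elems (rep_space (winding_rep Q (S, F)) i). x)"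
  unfolding winding_rep_hom_def
  by (rule restrict_ext, simp, rule restrict_ext)
    (auto simp: winding_space_eq qmap_id_def split: option.split)

text \<open>
  Both sides send a vertex \<open>x\<close> to zero unless \<open>x \<in> U\<close> and \<open>f x\<close> lies in the domain of \<open>\<psi>\<close>; as
  \<open>f x\<close> always lies in \<open>D\<close>, this is the domain of the composite.
\<close>

lemma winding_rep_hom_comp:
  assumes X: "is_winding Q (S, F)" and Y: "is_winding Q (S', F')" and S'': "is_quiver S''"
    and \<phi>: "is_winding_mor (S, F) (S', F') \<phi>" and \<psi>: "is_winding_mor (S', F') (S'', F'') \<psi>"
  shows "winding_rep_hom Q (S, F) (winding_mor_comp \<psi> \<phi>) =
    (\<lambda>i\<in>verts Q. compose (elems (rep_space (winding_rep Q (S, F)) i))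
      (winding_rep_hom Q (S', F') \<psi> i) (winding_rep_hom Q (S, F) \<phi> i))" (is "?L = ?R")
proof -
  note S = is_windingD(1)[OF X] and S' = is_windingD(1)[OF Y]
  show ?thesis
    using \<phi> S S'
  proof (cases rule: winding_morE)
    case \<phi>: (1 U D f g)
    have parts: "verts (upart \<phi>) = U" "vmap (cmap \<phi>) = f" by (simp_all add: \<phi>(1))
    have fU: "f v \<in> D" if "v \<in> U" for v using \<phi>(7) that by (auto simp: bij_betw_def)
    have up: "verts (upart (winding_mor_comp \<psi> \<phi>)) = {x \<in> U. f x \<in> verts (upart \<psi>)}"
      and vm: "\<And>x. x \<in> U \<Longrightarrow> f x \<in> verts (upart \<psi>) \<Longrightarrow>
        vmap (cmap (winding_mor_comp \<psi> \<phi>)) x = vmap (cmap \<psi>) (f x)"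
      using fU by (auto simp: winding_mor_comp_def Let_def quiver_preimage_def quiver_inter_def
          sub_quiver_def qmap_comp_def compose_eq \<phi>(1))
    show ?thesis
    proof (rule extensionalityI[of _ "verts Q"])
      fix v assume v: "v \<in> verts Q"
      show "?L v = ?R v"
      proof (rule extensionalityI[of _ "elems (winding_space (S, F) v)"])
        fix m assume m: "m \<in> elems (winding_space (S, F) v)"
        show "?L v m = ?R v m"
        proof (cases m)
          case None
          then show ?thesis using v m by (simp add: compose_eq winding_rep_hom_None)
        next
          case (Some x)
          then have x: "x \<in> verts S" "vmap F x = v" using m by (auto simp: winding_space_eq)
          have R: "?R v m = winding_rep_hom Q (S', F') \<psi> v (winding_rep_hom Q (S, F) \<phi> v (Some x))"
            using v m Some by (simp add: compose_eq)
          note L = winding_rep_hom_Some[OF X x(1), of "winding_mor_comp \<psi> \<phi>", unfolded x(2) up]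
          note \<phi>x = winding_rep_hom_Some[OF X x(1), of \<phi>, unfolded x(2)]
          show ?thesis
          proof (cases "x \<in> U")
            case True
            then have "f x \<in> verts S'" "vmap F' (f x) = v" using \<phi>(3,10) fU x by auto
            then have "winding_rep_hom Q (S', F') \<psi> v (Some (f x)) =
                (if f x \<in> verts (upart \<psi>) then Some (vmap (cmap \<psi>) (f x)) else None)"
              using winding_rep_hom_Some[OF Y, of "f x" \<psi>] by simp
            then show ?thesis unfolding R unfolding Some L \<phi>x parts using True vm by simp
          next
            case False
            then show ?thesis unfolding R unfolding Some L \<phi>x parts using v by (simp add: winding_rep_hom_None)
          qed
        qed
      qed (use v in \<open>simp_all add: winding_rep_hom_def compose_def\<close>)
    qed (simp_all add: winding_rep_hom_def)
  qed
qed

text \<open>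
  This includes the category axioms for windings, obtained from those for representations.
\<close>

lemma is_functor_winding_functor:
  fixes Q :: "('q, 'r) quiver"
  assumes Q: "is_quiver Q"
  shows "is_functor (winding_cat Q :: (('v, 'e, 'q, 'r) winding, ('v, 'e) winding_mor) cat)
    (rep_cat Q) (winding_functor Q)"
proof (rule is_functor_if_faithful[OF category_rep_cat[OF Q]])
  fix X Y Z :: "('v, 'e, 'q, 'r) winding" and \<phi> \<psi> :: "('v, 'e) winding_mor"
  obtain S F S' F' S'' F'' where XYZ: "X = (S, F)" "Y = (S', F')" "Z = (S'', F'')"
    by (metis surj_pair)
  assume X: "X \<in> Ob (winding_cat Q)"
  then have X': "is_winding Q (S, F)" by (simp add: winding_cat_def XYZ)
  show "obj_map (winding_functor Q) X \<in> Ob (rep_cat Q)"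
    using is_f1_rep_winding_rep[OF Q X'] by (simp add: winding_functor_def rep_cat_def XYZ)
  show "Ident (winding_cat Q) X \<in> Hom (winding_cat Q) X X"
    using winding_mor_id[OF is_windingD(1)[OF X']] by (simp add: winding_cat_def XYZ)
  show "hom_map (winding_functor Q) X X (Ident (winding_cat Q) X) =
      Ident (rep_cat Q) (obj_map (winding_functor Q) X)"
    using winding_rep_hom_id by (simp add: winding_functor_def rep_cat_def winding_cat_def XYZ)
  assume Y: "Y \<in> Ob (winding_cat Q)"
  then have Y': "is_winding Q (S', F')" by (simp add: winding_cat_def XYZ)
  show "inj_on (hom_map (winding_functor Q) X Y) (Hom (winding_cat Q) X Y)"
    using winding_rep_hom_inj[OF X' Y']
    by (auto simp: inj_on_def winding_functor_def winding_cat_def XYZ)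
  {
    assume "\<phi> \<in> Hom (winding_cat Q) X Y"
    then show "hom_map (winding_functor Q) X Y \<phi> \<in>
        Hom (rep_cat Q) (obj_map (winding_functor Q) X) (obj_map (winding_functor Q) Y)"
      using winding_rep_hom_in_Hom[OF Q X' Y']
      by (simp add: winding_functor_def rep_cat_def winding_cat_def XYZ)
  }
  assume "Z \<in> Ob (winding_cat Q)" and \<phi>: "\<phi> \<in> Hom (winding_cat Q) X Y" and \<psi>: "\<psi> \<in> Hom (winding_cat Q) Y Z"
  then have S'': "is_quiver S''" and \<phi>\<psi>: "is_winding_mor (S, F) (S', F') \<phi>" "is_winding_mor (S', F') (S'', F'') \<psi>"
    by (auto simp: winding_cat_def XYZ dest: is_windingD(1))
  show "Comp (winding_cat Q) X Y Z \<psi> \<phi> \<in> Hom (winding_cat Q) X Z"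
    using winding_mor_comp_closed[OF is_windingD(1)[OF X'] is_windingD(1)[OF Y'] S'' \<phi>\<psi>]
    by (simp add: winding_cat_def XYZ)
  show "hom_map (winding_functor Q) X Z (Comp (winding_cat Q) X Y Z \<psi> \<phi>) =
      Comp (rep_cat Q) (obj_map (winding_functor Q) X) (obj_map (winding_functor Q) Y)
        (obj_map (winding_functor Q) Z) (hom_map (winding_functor Q) Y Z \<psi>) (hom_map (winding_functor Q) X Y \<phi>)"
    using winding_rep_hom_comp[OF X' Y' S'' \<phi>\<psi>]
    by (simp add: winding_functor_def rep_cat_def winding_cat_def XYZ)
qed

lemma winding_functor_fully_faithful:
  assumes Q: "is_quiver Q" and X: "X \<in> Ob (winding_cat Q)" and Y: "Y \<in> Ob (winding_cat Q)"
  shows "bij_betw (hom_map (winding_functor Q) X Y) (Hom (winding_cat Q) X Y)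
    (Hom (rep_cat Q) (obj_map (winding_functor Q) X) (obj_map (winding_functor Q) Y))"
proof -
  obtain S F S' F' where XY: "X = (S, F)" "Y = (S', F')" by (metis surj_pair)
  have X': "is_winding Q (S, F)" and Y': "is_winding Q (S', F')"
    using X Y by (simp_all add: winding_cat_def XY)
  have "bij_betw (winding_rep_hom Q (S, F)) {\<phi>. is_winding_mor (S, F) (S', F') \<phi>}
      {h. is_f1_rep_hom Q (winding_rep Q (S, F)) (winding_rep Q (S', F')) h}"
    unfolding bij_betw_def
  proof
    show "inj_on (winding_rep_hom Q (S, F)) {\<phi>. is_winding_mor (S, F) (S', F') \<phi>}"
      using winding_rep_hom_inj[OF X' Y'] by (auto intro: inj_onI)
    show "winding_rep_hom Q (S, F) ` {\<phi>. is_winding_mor (S, F) (S', F') \<phi>} =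
        {h. is_f1_rep_hom Q (winding_rep Q (S, F)) (winding_rep Q (S', F')) h}"
      using winding_rep_hom_in_Hom[OF Q X' Y'] winding_rep_hom_surj[OF Q X' Y'] by blast
  qed
  then show ?thesis by (simp add: winding_functor_def rep_cat_def winding_cat_def XY)
qed

section \<open>The functor is essentially surjective\<close>

lemma ex_inj_on_UNIV:
  assumes "finite A" "infinite (UNIV :: 'b set)"
  shows "\<exists>f :: 'a \<Rightarrow> 'b. inj_on f A"
proof -
  obtain B :: "'b set" where "finite B" "card B = card A"
    using infinite_arbitrarily_large[OF assms(2)] by blast
  then obtain f where "bij_betw f A B" using finite_same_card_bij[OF assms(1)] by metis
  then show ?thesis by (auto simp: bij_betw_def)
qed

definition rep_points :: "('q, 'r) quiver \<Rightarrow> ('q, 'r, 'a) f1_rep \<Rightarrow> ('q \<times> 'a) set" where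
  "rep_points Q M = (SIGMA q:verts Q. elems (rep_space M q) - {f1_zero (rep_space M q)})"

text \<open>
  The arrows of the coefficient quiver: the pair \<open>(\<alpha>, m)\<close> stands for the arrow from \<open>m\<close> to its
  nonzero image under \<open>\<alpha>\<close>.
\<close>

definition rep_links :: "('q, 'r) quiver \<Rightarrow> ('q, 'r, 'a) f1_rep \<Rightarrow> ('r \<times> 'a) set" where
  "rep_links Q M = (SIGMA \<alpha>:arrows Q. {m \<in> elems (rep_space M (src Q \<alpha>)).
     rep_map M \<alpha> m \<noteq> f1_zero (rep_space M (tgt Q \<alpha>))})"

text \<open>
  The coefficient quiver of a representation in its standard basis. The injections \<open>i\<close> and \<open>j\<close>
  transport nonzero elements and nonzero matrix entries into given types of vertices and arrows.
\<close>

definition coefficient_quiver ::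
    "('q, 'r) quiver \<Rightarrow> ('q, 'r, 'a) f1_rep \<Rightarrow> ('q \<times> 'a \<Rightarrow> 'v) \<Rightarrow> ('r \<times> 'a \<Rightarrow> 'e) \<Rightarrow> ('v, 'e) quiver" where
  "coefficient_quiver Q M i j =
     \<lparr>verts = i ` rep_points Q M, arrows = j ` rep_links Q M,
      src = (\<lambda>e\<in>j ` rep_links Q M. case inv_into (rep_links Q M) j e of (\<alpha>, m) \<Rightarrow> i (src Q \<alpha>, m)),
      tgt = (\<lambda>e\<in>j ` rep_links Q M. case inv_into (rep_links Q M) j e of (\<alpha>, m) \<Rightarrow>
        i (tgt Q \<alpha>, rep_map M \<alpha> m))\<rparr>"

definition coefficient_map ::
    "('q, 'r) quiver \<Rightarrow> ('q, 'r, 'a) f1_rep \<Rightarrow> ('q \<times> 'a \<Rightarrow> 'v) \<Rightarrow> ('r \<times> 'a \<Rightarrow> 'e) \<Rightarrow> ('v, 'e, 'q, 'r) qmap" where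
  "coefficient_map Q M i j =
     \<lparr>vmap = (\<lambda>v\<in>i ` rep_points Q M. fst (inv_into (rep_points Q M) i v)),
      amap = (\<lambda>e\<in>j ` rep_links Q M. fst (inv_into (rep_links Q M) j e))\<rparr>"

lemma finite_rep_points:
  assumes "is_quiver Q" "is_f1_rep Q M"
  shows "finite (rep_points Q M)"
  using assms by (auto simp: rep_points_def is_quiver_def is_f1_rep_def is_f1_space_def intro!: finite_SigmaI)

lemma finite_rep_links:
  assumes "is_quiver Q" "is_f1_rep Q M"
  shows "finite (rep_links Q M)"
  unfolding rep_links_def
proof (rule finite_SigmaI)
  show "finite (arrows Q)" using assms by (simp add: is_quiver_def)
  fix \<alpha> assume "\<alpha> \<in> arrows Q"
  then have "finite (elems (rep_space M (src Q \<alpha>)))"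
    using assms src_in_verts[OF assms(1)] by (simp add: is_f1_rep_def is_f1_space_def)
  then show "finite {m \<in> elems (rep_space M (src Q \<alpha>)). rep_map M \<alpha> m \<noteq> f1_zero (rep_space M (tgt Q \<alpha>))}"
    by simp
qed

lemma rep_link_ends:
  assumes Q: "is_quiver Q" and M: "is_f1_rep Q M" and l: "(\<alpha>, m) \<in> rep_links Q M"
  shows "(src Q \<alpha>, m) \<in> rep_points Q M" "(tgt Q \<alpha>, rep_map M \<alpha> m) \<in> rep_points Q M"
proof -
  have \<alpha>: "\<alpha> \<in> arrows Q" and m: "m \<in> elems (rep_space M (src Q \<alpha>))"
    "rep_map M \<alpha> m \<noteq> f1_zero (rep_space M (tgt Q \<alpha>))"
    using l by (auto simp: rep_links_def)
  have "rep_map M \<alpha> (f1_zero (rep_space M (src Q \<alpha>))) = f1_zero (rep_space M (tgt Q \<alpha>))"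
    using M \<alpha> by (simp add: is_f1_rep_def f1_linear_def)
  then have "m \<noteq> f1_zero (rep_space M (src Q \<alpha>))" using m(2) by metis
  then show "(src Q \<alpha>, m) \<in> rep_points Q M" using \<alpha> m src_in_verts[OF Q \<alpha>] by (simp add: rep_points_def)
  show "(tgt Q \<alpha>, rep_map M \<alpha> m) \<in> rep_points Q M"
    using \<alpha> m tgt_in_verts[OF Q \<alpha>] rep_map_in[OF M \<alpha> m(1)] by (simp add: rep_points_def)
qed

lemma rep_link_unique:
  assumes M: "is_f1_rep Q M" and "(\<alpha>, m) \<in> rep_links Q M" "(\<alpha>, n) \<in> rep_links Q M"
    and "rep_map M \<alpha> m = rep_map M \<alpha> n"
  shows "m = n"
proof -
  have "f1_linear (rep_space M (src Q \<alpha>)) (rep_space M (tgt Q \<alpha>)) (rep_map M \<alpha>)"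
    using M assms(2) by (auto simp: is_f1_rep_def rep_links_def)
  then show ?thesis
    using assms(2-4) unfolding f1_linear_def rep_links_def by (auto elim: inj_onD)
qed

context
  fixes Q :: "('q, 'r) quiver" and M :: "('q, 'r, 'a) f1_rep"
    and i :: "'q \<times> 'a \<Rightarrow> 'v" and j :: "'r \<times> 'a \<Rightarrow> 'e"
  assumes Q: "is_quiver Q" and M: "is_f1_rep Q M"
    and i: "inj_on i (rep_points Q M)" and j: "inj_on j (rep_links Q M)"
begin

lemma coefficient_simps:
  "verts (coefficient_quiver Q M i j) = i ` rep_points Q M"
  "arrows (coefficient_quiver Q M i j) = j ` rep_links Q M"
  "(\<alpha>, m) \<in> rep_links Q M \<Longrightarrow> src (coefficient_quiver Q M i j) (j (\<alpha>, m)) = i (src Q \<alpha>, m)"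
  "(\<alpha>, m) \<in> rep_links Q M \<Longrightarrow> tgt (coefficient_quiver Q M i j) (j (\<alpha>, m)) = i (tgt Q \<alpha>, rep_map M \<alpha> m)"
  "(q, m) \<in> rep_points Q M \<Longrightarrow> vmap (coefficient_map Q M i j) (i (q, m)) = q"
  "(\<alpha>, m) \<in> rep_links Q M \<Longrightarrow> amap (coefficient_map Q M i j) (j (\<alpha>, m)) = \<alpha>"
  using i j by (simp_all add: coefficient_quiver_def coefficient_map_def)

text \<open>
  Two arrows with the same label and source are equal because each structure map is a function; with
  the same label and target they are equal because it is injective on elements with nonzero image.
\<close>

lemma is_winding_coefficient:
  "is_winding Q (coefficient_quiver Q M i j, coefficient_map Q M i j)"
proof -
  let ?S = "coefficient_quiver Q M i j" and ?F = "coefficient_map Q M i j"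
  have pts: "q \<in> verts Q" if "(q, m) \<in> rep_points Q M" for q m using that by (simp add: rep_points_def)
  have lks: "\<alpha> \<in> arrows Q" if "(\<alpha>, m) \<in> rep_links Q M" for \<alpha> m using that by (simp add: rep_links_def)
  have "is_quiver ?S"
    unfolding is_quiver_def
  proof (intro conjI PiE_I)
    show "finite (verts ?S)" "finite (arrows ?S)"
      using finite_rep_points[OF Q M] finite_rep_links[OF Q M] by (simp_all add: coefficient_simps)
    fix e
    show "src ?S e = undefined" "tgt ?S e = undefined" if "e \<notin> arrows ?S"
      using that by (simp_all add: coefficient_quiver_def)
    assume "e \<in> arrows ?S"
    then obtain \<alpha> m where l: "(\<alpha>, m) \<in> rep_links Q M" "e = j (\<alpha>, m)" by (auto simp: coefficient_simps)
    then show "src ?S e \<in> verts ?S" "tgt ?S e \<in> verts ?S"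
      using rep_link_ends[OF Q M l(1)] by (simp_all add: coefficient_simps)
  qed
  moreover have "quiver_map ?S Q ?F"
    unfolding quiver_map_def
  proof (intro conjI PiE_I ballI)
    show "vmap ?F v = undefined" if "v \<notin> verts ?S" for v
      using that by (simp add: coefficient_quiver_def coefficient_map_def)
    show "amap ?F e = undefined" if "e \<notin> arrows ?S" for e
      using that by (simp add: coefficient_quiver_def coefficient_map_def)
    show "vmap ?F v \<in> verts Q" if "v \<in> verts ?S" for v
      using that by (auto simp: coefficient_simps pts)
    show "amap ?F e \<in> arrows Q" if "e \<in> arrows ?S" for e
      using that by (auto simp: coefficient_simps lks)
    fix e assume "e \<in> arrows ?S"
    then obtain \<alpha> m where l: "(\<alpha>, m) \<in> rep_links Q M" "e = j (\<alpha>, m)" by (auto simp: coefficient_simps)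
    then show "src Q (amap ?F e) = vmap ?F (src ?S e)" "tgt Q (amap ?F e) = vmap ?F (tgt ?S e)"
      using rep_link_ends[OF Q M l(1)] by (simp_all add: coefficient_simps)
  qed
  moreover have "e = e'"
    if e: "e \<in> arrows ?S" "e' \<in> arrows ?S" "src ?S e = src ?S e' \<or> tgt ?S e = tgt ?S e'" "amap ?F e = amap ?F e'" for e e'
  proof -
    obtain \<alpha> m where l: "(\<alpha>, m) \<in> rep_links Q M" "e = j (\<alpha>, m)"
      using e(1) by (auto simp: coefficient_simps)
    obtain \<beta> n where l': "(\<beta>, n) \<in> rep_links Q M" "e' = j (\<beta>, n)"
      using e(2) by (auto simp: coefficient_simps)
    have \<beta>: "\<beta> = \<alpha>" using e(4) l l' by (simp add: coefficient_simps)
    note l'' = l'[unfolded \<beta>]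
    have "i (src Q \<alpha>, m) = i (src Q \<alpha>, n) \<or> i (tgt Q \<alpha>, rep_map M \<alpha> m) = i (tgt Q \<alpha>, rep_map M \<alpha> n)"
      using e(3) l l'' by (simp add: coefficient_simps)
    then have "m = n \<or> rep_map M \<alpha> m = rep_map M \<alpha> n"
      using i rep_link_ends[OF Q M l(1)] rep_link_ends[OF Q M l''(1)] by (auto dest: inj_onD)
    then have "m = n" using rep_link_unique[OF M l(1) l''(1)] by blast
    with l l'' show ?thesis by simp
  qed
  ultimately show ?thesis unfolding is_winding_def by auto
qed

end

lemma f1_linear_if_bij:
  assumes "f \<in> extensional (elems V)" "bij_betw f (elems V) (elems W)" "f (f1_zero V) = f1_zero W"
  shows "f1_linear V W f"
  unfolding f1_linear_def
proof (intro conjI)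
  show "f \<in> elems V \<rightarrow>\<^sub>E elems W" using assms(1,2) by (simp add: PiE_iff bij_betw_apply)
  show "inj_on f {x \<in> elems V. f x \<noteq> f1_zero W}"
    by (rule inj_on_subset[OF bij_betw_imp_inj_on[OF assms(2)]]) simp
qed (fact assms(3))

text \<open>
  The isomorphism sends the base point to zero and the vertex \<open>i (q, m)\<close> to \<open>m\<close>. The action agrees
  because \<open>\<alpha>\<close> maps \<open>m\<close> to zero exactly when no arrow labelled \<open>\<alpha>\<close> starts at \<open>i (src Q \<alpha>, m)\<close>.
\<close>

lemma coefficient_quiver_iso:
  fixes M :: "('q, 'r, 'v option) f1_rep" and i :: "'q \<times> 'v option \<Rightarrow> 'v" and j :: "'r \<times> 'v option \<Rightarrow> 'e"
  assumes Q: "is_quiver Q" and M: "is_f1_rep Q M"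
    and i: "inj_on i (rep_points Q M)" and j: "inj_on j (rep_links Q M)"
  shows "\<exists>\<phi>. iso_in (rep_cat Q) (winding_rep Q (coefficient_quiver Q M i j, coefficient_map Q M i j)) M \<phi>"
proof -
  let ?S = "coefficient_quiver Q M i j" and ?F = "coefficient_map Q M i j"
  let ?R = "winding_rep Q (?S, ?F)"
  let ?z = "\<lambda>q. f1_zero (rep_space M q)"
  note cs = coefficient_simps[OF Q M i j]
  note W = is_winding_coefficient[OF Q M i j]
  note R = is_f1_rep_winding_rep[OF Q W]
  define \<phi> where "\<phi> = (\<lambda>q\<in>verts Q. \<lambda>x\<in>elems (winding_space (?S, ?F) q).
    case x of None \<Rightarrow> ?z q | Some v \<Rightarrow> snd (inv_into (rep_points Q M) i v))"
  have zero: "?z q \<in> elems (rep_space M q)" if "q \<in> verts Q" for q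
    using M that by (simp add: is_f1_rep_def is_f1_space_def)
  have mem: "x \<in> elems (winding_space (?S, ?F) q) \<longleftrightarrow>
      x = None \<or> (\<exists>m. (q, m) \<in> rep_points Q M \<and> x = Some (i (q, m)))" for q x
    by (auto simp: winding_space_eq cs)
  have \<phi>_None: "\<phi> q None = ?z q" if "q \<in> verts Q" for q
    using that by (simp add: \<phi>_def winding_space_eq)
  have \<phi>_Some: "\<phi> q (Some (i (q, m))) = m" if "(q, m) \<in> rep_points Q M" for q m
  proof -
    have "q \<in> verts Q" using that by (simp add: rep_points_def)
    moreover have "Some (i (q, m)) \<in> elems (winding_space (?S, ?F) q)" using that mem by blast
    ultimately show ?thesis using that i by (simp add: \<phi>_def)
  qed
  have bij: "bij_betw (\<phi> q) (elems (winding_space (?S, ?F) q)) (elems (rep_space M q))" if q: "q \<in> verts Q" for q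
  proof (rule bij_betw_byWitness[where f' = "\<lambda>m. if m = ?z q then None else Some (i (q, m))"])
    have nz: "m \<noteq> ?z q" "m \<in> elems (rep_space M q)" if "(q, m) \<in> rep_points Q M" for m
      using that by (simp_all add: rep_points_def)
    have pt: "(q, m) \<in> rep_points Q M" if "m \<noteq> ?z q" "m \<in> elems (rep_space M q)" for m
      using that q by (simp add: rep_points_def)
    show "\<forall>x\<in>elems (winding_space (?S, ?F) q). (if \<phi> q x = ?z q then None else Some (i (q, \<phi> q x))) = x"
      using nz by (auto simp: mem \<phi>_None[OF q] \<phi>_Some)
    show "\<forall>m\<in>elems (rep_space M q). \<phi> q (if m = ?z q then None else Some (i (q, m))) = m"
      using pt by (auto simp: \<phi>_None[OF q] \<phi>_Some)
    show "\<phi> q ` elems (winding_space (?S, ?F) q) \<subseteq> elems (rep_space M q)"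
      using nz zero[OF q] by (auto simp: mem \<phi>_None[OF q] \<phi>_Some)
    show "(\<lambda>m. if m = ?z q then None else Some (i (q, m))) ` elems (rep_space M q)
        \<subseteq> elems (winding_space (?S, ?F) q)"
      unfolding image_subset_iff mem using pt by auto
  qed
  have "is_f1_rep_hom Q ?R M \<phi>"
    unfolding is_f1_rep_hom_iff[OF Q R]
  proof (intro conjI ballI)
    show "\<phi> \<in> extensional (verts Q)" by (simp add: \<phi>_def)
    show "f1_linear (rep_space ?R q) (rep_space M q) (\<phi> q)" if q: "q \<in> verts Q" for q
      unfolding rep_space_winding_rep[OF q]
    proof (rule f1_linear_if_bij)
      show "\<phi> q \<in> extensional (elems (winding_space (?S, ?F) q))" using q by (simp add: \<phi>_def)
      show "\<phi> q (f1_zero (winding_space (?S, ?F) q)) = ?z q" using \<phi>_None[OF q] by (simp add: winding_space_eq)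
    qed (rule bij[OF q])
  next
    fix \<alpha> x assume \<alpha>: "\<alpha> \<in> arrows Q" and "x \<in> elems (rep_space ?R (src Q \<alpha>))"
    note st = src_in_verts[OF Q \<alpha>] tgt_in_verts[OF Q \<alpha>]
    have x: "x \<in> elems (winding_space (?S, ?F) (src Q \<alpha>))"
      using \<open>x \<in> elems (rep_space ?R (src Q \<alpha>))\<close> st by simp
    have z: "rep_map M \<alpha> (?z (src Q \<alpha>)) = ?z (tgt Q \<alpha>)"
      using M \<alpha> by (simp add: is_f1_rep_def f1_linear_def)
    have "rep_map M \<alpha> (\<phi> (src Q \<alpha>) x) = \<phi> (tgt Q \<alpha>) (winding_action (?S, ?F) \<alpha> x)"
    proof (cases x)
      case None
      then show ?thesis using z st by (simp add: \<phi>_None)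
    next
      case (Some v)
      then obtain m where m: "(src Q \<alpha>, m) \<in> rep_points Q M" "x = Some (i (src Q \<alpha>, m))"
        using x mem by auto
      show ?thesis
      proof (cases "(\<alpha>, m) \<in> rep_links Q M")
        case True
        have "winding_action (?S, ?F) \<alpha> x = Some (i (tgt Q \<alpha>, rep_map M \<alpha> m))"
          unfolding m(2) winding_action_Some_iff[OF W]
          using True by (intro bexI[of _ "j (\<alpha>, m)"]) (simp_all add: cs)
        then show ?thesis using \<phi>_Some[OF m(1)] \<phi>_Some[OF rep_link_ends(2)[OF Q M True]] m(2) by simp
      next
        case False
        have "winding_action (?S, ?F) \<alpha> x \<noteq> Some y" for y
        proof
          assume "winding_action (?S, ?F) \<alpha> x = Some y"
          then obtain b where b: "b \<in> arrows ?S" "src ?S b = i (src Q \<alpha>, m)" "amap ?F b = \<alpha>"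
            unfolding m(2) winding_action_Some_iff[OF W] by blast
          obtain \<beta> n where l: "(\<beta>, n) \<in> rep_links Q M" "b = j (\<beta>, n)" using b(1) by (auto simp: cs)
          have \<beta>: "\<beta> = \<alpha>" using b(3) l by (simp add: cs)
          have "i (src Q \<alpha>, n) = i (src Q \<alpha>, m)" using b(2) l by (simp add: cs \<beta>)
          then have "n = m" using inj_onD[OF i _ rep_link_ends(1)[OF Q M l(1)[unfolded \<beta>]] m(1)] by simp
          then show False using l \<beta> False by simp
        qed
        then have "winding_action (?S, ?F) \<alpha> x = None" by (cases "winding_action (?S, ?F) \<alpha> x") auto
        moreover have "rep_map M \<alpha> m = ?z (tgt Q \<alpha>)"
          using False m(1) \<alpha> by (auto simp: rep_links_def rep_points_def)
        ultimately show ?thesis using \<phi>_Some[OF m(1)] m(2) st by (simp add: \<phi>_None)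
      qed
    qed
    then show "rep_map M \<alpha> (\<phi> (src Q \<alpha>) x) = \<phi> (tgt Q \<alpha>) (rep_map ?R \<alpha> x)"
      using rep_map_winding_rep[OF \<alpha> x] by simp
  qed
  then have "iso_in (rep_cat Q) ?R M \<phi>"
    by (rule iso_in_rep_cat_if_bij[OF Q R M]) (use bij in simp)
  then show ?thesis by blast
qed

section \<open>Nilpotent representations and acyclic quivers\<close>

lemma dpath_append: "dpath S v p u \<Longrightarrow> dpath S u q w \<Longrightarrow> dpath S v (p @ q) w"
  by (induction rule: dpath.induct) (auto intro: dpath.intros)

lemma dpath_concat_replicate:
  assumes "dpath S v p v" "v \<in> verts S"
  shows "dpath S v (concat (replicate n p)) v"
  by (induction n) (auto intro: dpath.intros dpath_append assms)

lemma dpath_prefix_to: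
  assumes S: "is_quiver S"
  shows "dpath S v p w \<Longrightarrow> u \<in> set (map (tgt S) p) \<Longrightarrow> \<exists>p'. p' \<noteq> [] \<and> dpath S v p' u"
proof (induction rule: dpath.induct)
  case (dpath_Cons a p w)
  show ?case
  proof (cases "u = tgt S a")
    case True
    then have "dpath S (src S a) [a] u" using dpath_Cons.hyps(1) tgt_in_verts[OF S] by (auto intro: dpath.intros)
    then show ?thesis by blast
  next
    case False
    then obtain p' where "dpath S (tgt S a) p' u" using dpath_Cons by auto
    then have "dpath S (src S a) (a # p') u" using dpath_Cons.hyps(1) by (auto intro: dpath.intros)
    then show ?thesis by blast
  qed
qed simp

text \<open>
  Were the first vertex of a path visited again, the part of the path up to that visit would be a
  cycle.
\<close>

lemma acyclic_dpath_distinct: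
  assumes S: "is_quiver S" and ac: "acyclic_quiver S"
  shows "dpath S v p w \<Longrightarrow> distinct (v # map (tgt S) p) \<and> set (v # map (tgt S) p) \<subseteq> verts S"
proof (induction rule: dpath.induct)
  case (dpath_Cons a p w)
  have path: "dpath S (src S a) (a # p) w" using dpath_Cons.hyps by (rule dpath.intros)
  have "src S a \<notin> set (map (tgt S) (a # p))"
    using dpath_prefix_to[OF S path] ac unfolding acyclic_quiver_def by blast
  then show ?case using dpath_Cons.IH src_in_verts[OF S dpath_Cons.hyps(1)] by simp
qed simp

lemma acyclic_dpath_length:
  assumes S: "is_quiver S" and ac: "acyclic_quiver S" and p: "dpath S v p w"
  shows "length p < card (verts S)"
proof -
  have "card (set (v # map (tgt S) p)) \<le> card (verts S)"
    using acyclic_dpath_distinct[OF S ac p] S by (intro card_mono) (auto simp: is_quiver_def)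
  then show ?thesis using distinct_card[of "v # map (tgt S) p"] acyclic_dpath_distinct[OF S ac p] by simp
qed

lemma fold_winding_rep_dpath:
  assumes Q: "is_quiver Q" and X: "is_winding Q (S, F)"
  shows "dpath S x p y \<Longrightarrow> dpath Q (vmap F x) (map (amap F) p) (vmap F y) \<and>
    fold (rep_map (winding_rep Q (S, F))) (map (amap F) p) (Some x) = Some y"
proof (induction rule: dpath.induct)
  case (dpath_Nil v)
  then show ?case using is_windingD(2)[OF X] by (auto intro: dpath.intros)
next
  case (dpath_Cons a p w)
  note a = dpath_Cons.hyps(1)
  have "dpath Q (src Q (amap F a)) (amap F a # map (amap F) p) (vmap F w)"
    using dpath_Cons.IH is_windingD(3,5)[OF X a] by (auto intro!: dpath.intros)
  moreover have "rep_map (winding_rep Q (S, F)) (amap F a) (Some (src S a)) = Some (tgt S a)"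
  proof -
    have "Some (src S a) \<in> elems (winding_space (S, F) (src Q (amap F a)))"
      using is_windingD(4)[OF X a] src_in_verts[OF is_windingD(1)[OF X] a] by (simp add: winding_space_eq)
    moreover have "winding_action (S, F) (amap F a) (Some (src S a)) = Some (tgt S a)"
      unfolding winding_action_Some_iff[OF X] using a by blast
    ultimately show ?thesis by (simp add: rep_map_winding_rep[OF is_windingD(3)[OF X a]])
  qed
  ultimately show ?case using dpath_Cons.IH is_windingD(4)[OF X a] by simp
qed

text \<open>
  Applying the structure maps along a path of \<open>Q\<close> with nonzero result traces out a path of \<open>S\<close> over it.
\<close>

lemma dpath_lift_fold_winding_rep:
  assumes Q: "is_quiver Q" and X: "is_winding Q (S, F)"
  shows "dpath Q v p w \<Longrightarrow> m \<in> elems (winding_space (S, F) v)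
    \<Longrightarrow> fold (rep_map (winding_rep Q (S, F))) p m = Some y
    \<Longrightarrow> \<exists>x p'. m = Some x \<and> dpath S x p' y \<and> map (amap F) p' = p"
proof (induction arbitrary: m rule: dpath.induct)
  case (dpath_Nil v)
  then have "y \<in> verts S" by (auto simp: winding_space_eq)
  then show ?case using dpath_Nil.prems by (auto intro: dpath.intros)
next
  case (dpath_Cons a p w)
  note a = dpath_Cons.hyps(1)
  have in_src: "m \<in> elems (winding_space (S, F) (src Q a))" by (rule dpath_Cons.prems(1))
  have eq: "rep_map (winding_rep Q (S, F)) a m = winding_action (S, F) a m"
    by (rule rep_map_winding_rep[OF a in_src])
  have "rep_map (winding_rep Q (S, F)) a m \<in> elems (rep_space (winding_rep Q (S, F)) (tgt Q a))"
    using rep_map_in[OF is_f1_rep_winding_rep[OF Q X] a] in_src src_in_verts[OF Q a] by simp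
  then obtain x p' where x: "winding_action (S, F) a m = Some x" "dpath S x p' y" "map (amap F) p' = p"
    using dpath_Cons.IH[of "winding_action (S, F) a m"] dpath_Cons.prems(2) tgt_in_verts[OF Q a] eq by auto
  then obtain x' where x': "m = Some x'" by (cases m) auto
  then obtain b where b: "b \<in> arrows S" "src S b = x'" "tgt S b = x" "amap F b = a"
    using x(1) winding_action_Some_iff[OF X] by blast
  then have "dpath S x' (b # p') y" using x(2) by (auto intro: dpath.intros)
  then show ?case using x' x(3) b(4) by (metis list.simps(9))
qed

text \<open>
  Nonzero composites correspond to paths in \<open>S\<close> of the same length. Without cycles these are shorter
  than the number of vertices; the powers of a cycle give nonzero composites of unbounded length.
\<close>

lemma nilpotent_winding_rep_iff:
  assumes Q: "is_quiver Q" and X: "is_winding Q (S, F)"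
  shows "nilpotent_rep Q (winding_rep Q (S, F)) \<longleftrightarrow> acyclic_quiver S"
proof
  note S = is_windingD(1)[OF X]
  have zero: "f1_zero (rep_space (winding_rep Q (S, F)) w) = None" if "w \<in> verts Q" for w
    using that by (simp add: winding_space_eq)
  {
    assume ac: "acyclic_quiver S"
    have "fold (rep_map (winding_rep Q (S, F))) p m = f1_zero (rep_space (winding_rep Q (S, F)) w)"
      if p: "dpath Q v p w" "length p \<ge> Suc (card (verts S))"
        and m: "m \<in> elems (rep_space (winding_rep Q (S, F)) v)" for v p w m
    proof (rule ccontr)
      have vw: "v \<in> verts Q" "w \<in> verts Q" using dpath_ends[OF p(1) Q] by auto
      assume "fold (rep_map (winding_rep Q (S, F))) p m \<noteq> f1_zero (rep_space (winding_rep Q (S, F)) w)"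
      then obtain y where "fold (rep_map (winding_rep Q (S, F))) p m = Some y" unfolding zero[OF vw(2)] by blast
      then obtain x p' where "dpath S x p' y" "map (amap F) p' = p"
        using dpath_lift_fold_winding_rep[OF Q X p(1)] m vw(1) by fastforce
      then have "length p < card (verts S)" using acyclic_dpath_length[OF S ac] by fastforce
      then show False using p(2) by simp
    qed
    then show "nilpotent_rep Q (winding_rep Q (S, F))"
      (* the successor makes the bound positive *)
      unfolding nilpotent_rep_def by (intro exI[of _ "Suc (card (verts S))"]) blast
  }
  {
    assume nil: "nilpotent_rep Q (winding_rep Q (S, F))"
    show "acyclic_quiver S"
      unfolding acyclic_quiver_def
    proof (intro notI, elim exE conjE)
      fix v p assume p: "p \<noteq> []" "dpath S v p v"
      have v: "v \<in> verts S" using dpath_ends[OF p(2) S] by simp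
      obtain N where N: "\<And>n u q w m. n \<ge> N \<Longrightarrow> dpath Q u q w \<Longrightarrow> length q = n
        \<Longrightarrow> m \<in> elems (rep_space (winding_rep Q (S, F)) u)
        \<Longrightarrow> fold (rep_map (winding_rep Q (S, F))) q m = f1_zero (rep_space (winding_rep Q (S, F)) w)"
        using nil unfolding nilpotent_rep_def by metis
      define q where "q = concat (replicate N p)"
      have "length q = N * length p" by (simp add: q_def length_concat sum_list_replicate)
      then have len: "length (map (amap F) q) \<ge> N" using p(1) by (cases p) simp_all
      have q: "dpath S v q v" unfolding q_def by (rule dpath_concat_replicate[OF p(2) v])
      note lift = fold_winding_rep_dpath[OF Q X q]
      have Fv: "vmap F v \<in> verts Q" by (rule is_windingD(2)[OF X v])
      have "Some v \<in> elems (rep_space (winding_rep Q (S, F)) (vmap F v))"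
        using v Fv by (simp add: winding_space_eq)
      from N[OF len conjunct1[OF lift] refl this] show False
        using lift zero[OF Fv] by simp
    qed
  }
qed

section \<open>The equivalence\<close>

theorem theoremA:
  fixes Q :: "('q, 'r) quiver"
  assumes "is_quiver Q"
    and "infinite (UNIV :: 'v set)" and "infinite (UNIV :: 'e set)"
  shows "\<exists>G \<eta> \<epsilon>.
    cat_equivalence
      (winding_cat Q :: (('v, 'e, 'q, 'r) winding, ('v, 'e) winding_mor) cat)
      (rep_cat Q)
      (winding_functor Q) G \<eta> \<epsilon> \<and>
    cat_equivalence
      (full_subcategory (winding_cat Q) (\<lambda>(S, F). acyclic_quiver S))
      (full_subcategory (rep_cat Q) (nilpotent_rep Q))
      (winding_functor Q) G \<eta> \<epsilon>"
proof -
  note Q = assms(1)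
  let ?C = "winding_cat Q :: (('v, 'e, 'q, 'r) winding, ('v, 'e) winding_mor) cat"
  have ess: "\<exists>X\<in>Ob ?C. \<exists>f. iso_in (rep_cat Q) (obj_map (winding_functor Q) X) M f"
    if "M \<in> Ob (rep_cat Q)" for M :: "('q, 'r, 'v option) f1_rep"
  proof -
    have M: "is_f1_rep Q M" using that by (simp add: rep_cat_def)
    obtain i :: "'q \<times> 'v option \<Rightarrow> 'v" where i: "inj_on i (rep_points Q M)"
      using ex_inj_on_UNIV[OF finite_rep_points[OF Q M] assms(2)] by blast
    obtain j :: "'r \<times> 'v option \<Rightarrow> 'e" where j: "inj_on j (rep_links Q M)"
      using ex_inj_on_UNIV[OF finite_rep_links[OF Q M] assms(3)] by blast
    show ?thesis
      using is_winding_coefficient[OF Q M i j] coefficient_quiver_iso[OF Q M i j]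
      by (intro bexI[of _ "(coefficient_quiver Q M i j, coefficient_map Q M i j)"])
        (simp_all add: winding_functor_def winding_cat_def)
  qed
  obtain G \<eta> \<epsilon> where E: "cat_equivalence ?C (rep_cat Q) (winding_functor Q) G \<eta> \<epsilon>"
    using cat_equivalence_if_fully_faithful_ess_surj[OF is_functor_winding_functor[OF Q]
        winding_functor_fully_faithful[OF Q] ess] by blast
  moreover have "cat_equivalence (full_subcategory ?C (\<lambda>(S, F). acyclic_quiver S))
      (full_subcategory (rep_cat Q) (nilpotent_rep Q)) (winding_functor Q) G \<eta> \<epsilon>"
  proof (rule cat_equivalence_full_subcategory[OF E])
    show "(case X of (S, F) \<Rightarrow> acyclic_quiver S) \<longleftrightarrow> nilpotent_rep Q (obj_map (winding_functor Q) X)"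
      if "X \<in> Ob ?C" for X
      using that by (cases X) (simp add: winding_cat_def winding_functor_def nilpotent_winding_rep_iff[OF Q])
    show "nilpotent_rep Q M"
      if "M \<in> Ob (rep_cat Q)" "N \<in> Ob (rep_cat Q)" "iso_in (rep_cat Q) M N f" "nilpotent_rep Q N"
      for M N :: "('q, 'r, 'v option) f1_rep" and f
      using nilpotent_rep_iso[OF Q _ _ that(3,4)] that(1,2) by (simp add: rep_cat_def)
  qed
  ultimately show ?thesis by blast
qed

end
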